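(* Let $I$ be a binary image with a dual irregular graph pyramid $(G_0,\bar G_0),\dots,(G_n,\bar G_n)$, let $K^0$ be the boundary cell complex of level $0$, let $K^H$ be the homology-generator level, with self-loops $\alpha_1,\dots,\alpha_m$ surrounding the holes $O_1,\dots,O_m$ of the object and self-loop $\beta$ surrounding the foreground face $f$, and let $\alpha_i^*$ be the $1$-cochain of $K^H$ defined by the set $\{\alpha_i,\beta\}$. Then: 1. For every $i$, the down projection of $\alpha_i^*$ blocks the creation of the hole $O_i$: if $g$ is any $1$-cycle of $K^0$ (over $\mathbb{Z}/2$) homologous in $K^0$ to the down projection of the cycle $\alpha_i$, then the down projection of $\alpha_i^*$ contains an odd number of edges of $g$. 2. For every $i$, the down projection of $\alpha_i^*$ is a $1$-cocycle of $K^0$. Moreover, the down projections of $\alpha_1^*,\dots,\alpha_m^*$ form a basis of representative $1$-cocycles of $K^0$.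
   Context: All chains and cochains have $\mathbb{Z}/2$ coefficients. A $p$-cochain is identified with the set of $p$-cells on which it takes the value $1$. A set $\{c_1,\dots,c_m\}$ of $p$-cocycles is a basis of representative $p$-cocycles if every $p$-cocycle is a linear combination of the $c_i$ plus a $p$-coboundary, and no $c_i$ is a linear combination of the others plus a $p$-coboundary. Image and pyramid. $I$ is a rectangular 2D image with pixels labelled "object" (foreground) or "background"; the object is a 4-connected set of pixels, and the pixels on the image border are background. $G_0$ has one vertex per pixel and an edge for each pair of 4-adjacent pixels; $\bar G_0$ is its plane dual, so faces of $\bar G_0$ correspond to pixels and edges of $\bar G_0$ to the common sides of 4-adjacent pixels. A dual irregular graph pyramid is a finite sequence of pairs of dual plane multigraphs $(G_k,\bar G_k)$, $0\le k\le n$, where $(G_{k+1},\bar G_{k+1})$ is obtained from $(G_k,\bar G_k)$ as follows: (i) choose a nonempty forest $T_k$ of edges of $G_k$, each joining two vertices with the same label, and contract it (equivalently, remove the dual edges from $\bar G_k$; these are the removal edges of $\bar G_k$); (ii) contract all pendant trees of the resulting boundary graph (removing the dual edges); (iii) for each vertex of degree 2 of the resulting boundary graph contract one distinct incident edge, the contracted edges forming a forest (again removing the dual edges). The process stops at $n$ when no non-loop edge of $G_n$ joins vertices with the same label. The trees of $T_k$ (and isolated vertices) are the contraction kernels of $G_k$; in each of them one vertex is chosen as surviving vertex (root). Edges of every level are identified with the base-level edges from which they survive. The receptive field of a vertex of $G_k$ is the set of pixels merged into it. Complexes. $K^k$, the boundary cell complex of level $k$, consists of all faces of $\bar G_k$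 whose corresponding vertex of $G_k$ has a receptive field of object pixels only, together with all edges and vertices in their boundaries. The homology-generator level $K^H$ is obtained from $K^n$ by contracting a spanning tree of $\bar G_n$. It has one vertex, one face $f$ (the object), and as edges self-loops $\alpha_1,\dots,\alpha_m$, each surrounding one background region $O_i$ (a hole of the object), and one self-loop $\beta$ surrounding $f$, i.e. separating $f$ from the outside background. Down projection of the cycle $\alpha_i$: the unique $1$-cycle of $K^0$ consisting of the base-level edge surviving to $\alpha_i$ together with edges of $K^0$ that are contracted in the boundary graphs during the construction of the pyramid and of $K^H$ (this is $\iota_1(\alpha_i)$ for the inclusion map $\iota_1:C_1(K^H)\to C_1(K^0)$). Down projection of the cocycle $\alpha_i^*$: put $A_n=\{\alpha_i,\beta\}$ (as surviving edges in $\bar G_n$). For $k=n,\dots,1$ set $A_{k-1}=A^s_{k-1}\cup A^r_{k-1}$, where $A^s_{k-1}$ is the set of edges of $\bar G_{k-1}$ that survive to the edges in $A_k$, and $A^r_{k-1}$ is obtained as follows. In each contraction kernel $T$ of $G_{k-1}$ with object label, orient the edges toward the root, so that every non-root vertex $v$ is the starting vertex of a unique edge of $T$. From the leaves to the root, label each non-root $v$ by the number of edges of $A^s_{k-1}$ that lie in the boundary of the face of $\bar G_{k-1}$ associated to $v$, plus the labels of the children of $v$. A removal edge of $\bar G_{k-1}$ is in $A^r_{k-1}$ iff the starting vertex of its dual edge in the kernel has an odd label. The down projection of $\alpha_i^*$ is $A_0$, a set of edges of $K^0$. *)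

theory Defs
  imports Main
begin

section \<open>Multigraphs, contraction and removal\<close>

text \<open>
  Vertices are sets of ``points''. Contracting edges replaces the merged vertices by their
  union, so that a vertex of a level is literally its receptive field. Edges keep their
  identity under contraction and removal (an edge of a level is the base-level edge from which
  it survives), and an edge and its dual edge are the same element of type \<open>'e\<close>.
  A self-loop at \<open>v\<close> has \<open>ends = {v}\<close>.
\<close>

record ('a, 'e) mgraph =
  verts :: "'a set set"
  edges :: "'e set"
  ends :: "'e \<Rightarrow> 'a set set"

definition joined :: "('a, 'e) mgraph \<Rightarrow> 'e set \<Rightarrow> ('a set \<times> 'a set) set" where
  "joined G S = {(u, v). \<exists>e\<in>S. ends G e = {u, v}}\<^sup>*"

definition forest :: "('a, 'e) mgraph \<Rightarrow> 'e set \<Rightarrow> bool" where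
  "forest G S \<longleftrightarrow> S \<subseteq> edges G \<and>
     (\<forall>e\<in>S. \<forall>u v. ends G e = {u, v} \<longrightarrow> (u, v) \<notin> joined G (S - {e}))"

definition spanning_tree :: "('a, 'e) mgraph \<Rightarrow> 'e set \<Rightarrow> bool" where
  "spanning_tree G S \<longleftrightarrow> forest G S \<and> (\<forall>u\<in>verts G. \<forall>v\<in>verts G. (u, v) \<in> joined G S)"

definition merged :: "('a, 'e) mgraph \<Rightarrow> 'e set \<Rightarrow> 'a set \<Rightarrow> 'a set" where
  "merged G S v = \<Union> (joined G S `` {v})"

definition contract :: "'e set \<Rightarrow> ('a, 'e) mgraph \<Rightarrow> ('a, 'e) mgraph" where
  "contract S G = \<lparr>verts = merged G S ` verts G, edges = edges G - S,
     ends = (\<lambda>e. merged G S ` ends G e)\<rparr>"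

definition remove :: "'e set \<Rightarrow> ('a, 'e) mgraph \<Rightarrow> ('a, 'e) mgraph" where
  "remove S G = \<lparr>verts = verts G, edges = edges G - S, ends = ends G\<rparr>"

definition degree :: "('a, 'e) mgraph \<Rightarrow> 'a set \<Rightarrow> nat" where
  "degree G v = card {e \<in> edges G. v \<in> ends G e} + card {e \<in> edges G. ends G e = {v}}"

text \<open>
  An edge belongs to a pendant tree iff deleting it splits off a component without cycles.
\<close>

definition pendant_edges :: "('a, 'e) mgraph \<Rightarrow> 'e set" where
  "pendant_edges G = {e \<in> edges G. \<exists>u v. ends G e = {u, v} \<and>
     (u, v) \<notin> joined G (edges G - {e}) \<and>
     forest G {e' \<in> edges G - {e}. ends G e' \<subseteq> joined G (edges G - {e}) `` {u}}}"

text \<open>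
  A choice \<open>S\<close> of one distinct incident edge for each vertex of degree 2, forming a forest.
  If \<^emph>\<open>all\<close> vertices have degree 2, the (connected) boundary graph is a single cycle and such a
  choice would use the whole cycle; then exactly one vertex is left without an edge.
\<close>

definition degree2_choice :: "('a, 'e) mgraph \<Rightarrow> 'e set \<Rightarrow> bool" where
  "degree2_choice G S \<longleftrightarrow> forest G S \<and>
     (\<exists>D c. (let D2 = {v \<in> verts G. degree G v = 2} in
              if D2 = verts G then \<exists>v0\<in>D2. D = D2 - {v0} else D = D2) \<and>
            inj_on c D \<and> (\<forall>v\<in>D. c v \<in> edges G \<and> v \<in> ends G (c v)) \<and> S = c ` D)"


section \<open>Binary images\<close>

text \<open>
  The pixel \<open>(i, j)\<close> is the unit square with lower left corner \<open>(i, j)\<close>; the image consists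
  of the pixels with \<open>i < w\<close> and \<open>j < h\<close>, and \<open>F\<close> is the object (foreground).
\<close>

type_synonym point = "nat \<times> nat"
type_synonym edge = "point set"

definition pixels :: "nat \<Rightarrow> nat \<Rightarrow> point set" where
  "pixels w h = {..<w} \<times> {..<h}"

definition adj4 :: "(point \<times> point) set" where
  "adj4 = {((i, j), (i', j')). i = i' \<and> (j' = Suc j \<or> j = Suc j') \<or>
                              j = j' \<and> (i' = Suc i \<or> i = Suc i')}"

definition region :: "point set \<Rightarrow> point \<Rightarrow> point set" where
  "region X p = (Restr adj4 X)\<^sup>* `` {p}"

definition binary_image :: "nat \<Rightarrow> nat \<Rightarrow> point set \<Rightarrow> bool" where
  "binary_image w h F \<longleftrightarrow> F \<noteq> {} \<and> F \<subseteq> pixels w h \<and> (\<forall>p\<in>F. region F p = F) \<and>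
     (\<forall>(i, j)\<in>F. 0 < i \<and> Suc i < w \<and> 0 < j \<and> Suc j < h)"

text \<open>The outside background is the background region containing the image border.\<close>

definition outside :: "nat \<Rightarrow> nat \<Rightarrow> point set \<Rightarrow> point set" where
  "outside w h F = region (pixels w h - F) (0, 0)"

definition holes :: "nat \<Rightarrow> nat \<Rightarrow> point set \<Rightarrow> point set set" where
  "holes w h F = region (pixels w h - F) ` (pixels w h - F) - {outside w h F}"


section \<open>The base level\<close>

text \<open>An edge is the set of its two 4-adjacent pixels.\<close>

definition base_edges :: "nat \<Rightarrow> nat \<Rightarrow> edge set" where
  "base_edges w h = {{p, q} | p q. p \<in> pixels w h \<and> q \<in> pixels w h \<and> (p, q) \<in> adj4}"

definition base_graph :: "nat \<Rightarrow> nat \<Rightarrow> (point, edge) mgraph" where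
  "base_graph w h = \<lparr>verts = (\<lambda>p. {p}) ` pixels w h, edges = base_edges w h,
     ends = (\<lambda>e. (\<lambda>p. {p}) ` e)\<rparr>"

text \<open>
  Vertices of the plane dual are the bounded faces of the pixel grid graph, i.e. the interior
  grid points of the image, and its unbounded face, represented by the set of all grid points
  on the rim of the image.
\<close>

definition dual_vertex :: "nat \<Rightarrow> nat \<Rightarrow> point \<Rightarrow> point set" where
  "dual_vertex w h c = (if c \<in> {0<..<w} \<times> {0<..<h} then {c}
     else {..w} \<times> {..h} - {0<..<w} \<times> {0<..<h})"

definition corners :: "point \<Rightarrow> point set" where
  "corners = (\<lambda>(i, j). {i, Suc i} \<times> {j, Suc j})"

definition base_dual :: "nat \<Rightarrow> nat \<Rightarrow> (point, edge) mgraph" where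
  "base_dual w h = \<lparr>verts = dual_vertex w h ` ({..w} \<times> {..h}), edges = base_edges w h,
     ends = (\<lambda>e. dual_vertex w h ` (\<Inter>p\<in>e. corners p))\<rparr>"


section \<open>Dual irregular graph pyramids\<close>

text \<open>
  \<open>T k\<close> is the forest of edges contracted in \<open>G k\<close>, \<open>R k\<close> the set of surviving vertices, one in
  each contraction kernel, and \<open>S k\<close> the set of edges contracted because of vertices of degree 2.
  A vertex has the label ``object'' iff its receptive field is contained in \<open>F\<close>; receptive fields
  never mix labels.
\<close>

definition contraction_kernels ::
  "'a set \<Rightarrow> ('a, 'e) mgraph \<Rightarrow> 'e set \<Rightarrow> 'a set set \<Rightarrow> bool" where
  "contraction_kernels F G T R \<longleftrightarrow> forest G T \<and> T \<noteq> {} \<and>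
     (\<forall>e\<in>T. \<forall>u\<in>ends G e. \<forall>v\<in>ends G e. u \<subseteq> F \<longleftrightarrow> v \<subseteq> F) \<and>
     R \<subseteq> verts G \<and> (\<forall>v\<in>verts G. \<exists>!r. r \<in> R \<and> (v, r) \<in> joined G T)"

definition graph_pyramid ::
  "nat \<Rightarrow> nat \<Rightarrow> point set \<Rightarrow> nat \<Rightarrow> (nat \<Rightarrow> (point, edge) mgraph) \<Rightarrow>
   (nat \<Rightarrow> (point, edge) mgraph) \<Rightarrow> (nat \<Rightarrow> edge set) \<Rightarrow> (nat \<Rightarrow> point set set) \<Rightarrow>
   (nat \<Rightarrow> edge set) \<Rightarrow> bool" where
  "graph_pyramid w h F n G Gd T R S \<longleftrightarrow>
     G 0 = base_graph w h \<and> Gd 0 = base_dual w h \<and>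
     (\<forall>k<n. contraction_kernels F (G k) (T k) (R k) \<and>
        (let G1 = contract (T k) (G k); Gd1 = remove (T k) (Gd k);
             P = pendant_edges Gd1;
             G2 = remove P G1; Gd2 = contract P Gd1
         in degree2_choice Gd2 (S k) \<and>
            G (Suc k) = remove (S k) G2 \<and> Gd (Suc k) = contract (S k) Gd2)) \<and>
     (\<forall>e\<in>edges (G n). \<forall>u v. ends (G n) e = {u, v} \<and> u \<noteq> v \<longrightarrow> \<not> (u \<subseteq> F \<longleftrightarrow> v \<subseteq> F))"


section \<open>Cell complexes with coefficients in \<open>\<int>/2\<close>\<close>

text \<open>
  Chains and cochains are sets of cells; \<open>bd1\<close> and \<open>bd2\<close> are the mod 2 boundaries of single
  edges and faces. Addition is symmetric difference.
\<close>

record ('v, 'e, 'f) cell_complex =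
  cverts :: "'v set"
  cedges :: "'e set"
  cfaces :: "'f set"
  bd1 :: "'e \<Rightarrow> 'v set"
  bd2 :: "'f \<Rightarrow> 'e set"

definition mod2_sum :: "('i \<Rightarrow> 'x set) \<Rightarrow> 'i set \<Rightarrow> 'x set" where
  "mod2_sum c J = {x. odd (card {i \<in> J. x \<in> c i})}"

definition cycles1 :: "('v, 'e, 'f) cell_complex \<Rightarrow> 'e set set" where
  "cycles1 K = {z. z \<subseteq> cedges K \<and> mod2_sum (bd1 K) z = {}}"

definition homologous1 :: "('v, 'e, 'f) cell_complex \<Rightarrow> 'e set \<Rightarrow> 'e set \<Rightarrow> bool" where
  "homologous1 K y z \<longleftrightarrow> (\<exists>X \<subseteq> cfaces K. sym_diff y z = mod2_sum (bd2 K) X)"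

definition coboundary0 :: "('v, 'e, 'f) cell_complex \<Rightarrow> 'v set \<Rightarrow> 'e set" where
  "coboundary0 K a = {e \<in> cedges K. odd (card (a \<inter> bd1 K e))}"

definition coboundary1 :: "('v, 'e, 'f) cell_complex \<Rightarrow> 'e set \<Rightarrow> 'f set" where
  "coboundary1 K c = {f \<in> cfaces K. odd (card (c \<inter> bd2 K f))}"

definition cocycles1 :: "('v, 'e, 'f) cell_complex \<Rightarrow> 'e set set" where
  "cocycles1 K = {c. c \<subseteq> cedges K \<and> coboundary1 K c = {}}"

definition coboundaries1 :: "('v, 'e, 'f) cell_complex \<Rightarrow> 'e set set" where
  "coboundaries1 K = coboundary0 K ` Pow (cverts K)"

definition cocycle_basis1 ::
  "('v, 'e, 'f) cell_complex \<Rightarrow> ('i \<Rightarrow> 'e set) \<Rightarrow> 'i set \<Rightarrow> bool" where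
  "cocycle_basis1 K c J \<longleftrightarrow>
     (\<forall>i\<in>J. c i \<in> cocycles1 K) \<and>
     (\<forall>z\<in>cocycles1 K. \<exists>J'\<subseteq>J. \<exists>b\<in>coboundaries1 K. z = sym_diff (mod2_sum c J') b) \<and>
     (\<forall>i\<in>J. \<not> (\<exists>J'\<subseteq>J - {i}. \<exists>b\<in>coboundaries1 K. c i = sym_diff (mod2_sum c J') b))"

text \<open>
  The cell complex of a level: faces of the boundary graph \<open>Gd\<close> are the vertices of \<open>G\<close>, and \<open>e\<close> lies
  in the boundary of the faces \<open>ends G e\<close>. An edge with the same face on both sides, or with
  equal end points, contributes \<open>1 + 1 = 0\<close> to the respective boundary.
\<close>

definition boundary_complex ::
  "'a set \<Rightarrow> ('a, 'e) mgraph \<Rightarrow> ('a, 'e) mgraph \<Rightarrow> ('a set, 'e, 'a set) cell_complex" where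
  "boundary_complex F G Gd =
     (let Fs = {v \<in> verts G. v \<subseteq> F}; Es = {e \<in> edges G. ends G e \<inter> Fs \<noteq> {}} in
      \<lparr>cverts = \<Union> (ends Gd ` Es), cedges = Es, cfaces = Fs,
       bd1 = (\<lambda>e. if \<exists>v. ends Gd e = {v} then {} else ends Gd e),
       bd2 = (\<lambda>f. {e \<in> edges G. f \<in> ends G e \<and> ends G e \<noteq> {f}})\<rparr>)"


section \<open>Down projections\<close>

text \<open>
  The down projection of a cycle given by a surviving edge \<open>a\<close>; \<open>Z\<close> is the spanning tree of
  \<open>Gd n\<close> contracted to obtain the homology-generator level.
\<close>

definition contracted_edges ::
  "nat \<Rightarrow> (nat \<Rightarrow> ('a, 'e) mgraph) \<Rightarrow> (nat \<Rightarrow> 'e set) \<Rightarrow> (nat \<Rightarrow> 'e set) \<Rightarrow> 'e set \<Rightarrow> 'e set" where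
  "contracted_edges n Gd T S Z =
     (\<Union>k<n. pendant_edges (remove (T k) (Gd k)) \<union> S k) \<union> Z"

definition cycle_down_projection ::
  "('v, 'e, 'f) cell_complex \<Rightarrow> 'e set \<Rightarrow> 'e \<Rightarrow> 'e set" where
  "cycle_down_projection K0 C a = (THE z. z \<in> cycles1 K0 \<and> a \<in> z \<and> z - {a} \<subseteq> C)"

text \<open>
  The edge \<open>e\<close> of a contraction kernel, oriented toward the root, goes from \<open>u\<close> to \<open>v\<close>: the root
  is on the side of \<open>v\<close> when \<open>e\<close> is cut.
\<close>

definition kernel_arc ::
  "('a, 'e) mgraph \<Rightarrow> 'e set \<Rightarrow> 'a set set \<Rightarrow> 'a set \<Rightarrow> 'e \<Rightarrow> 'a set \<Rightarrow> bool" where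
  "kernel_arc G T R u e v \<longleftrightarrow> e \<in> T \<and> ends G e = {u, v} \<and> u \<noteq> v \<and>
     (\<exists>r\<in>R. (v, r) \<in> joined G (T - {e}))"

inductive kernel_label ::
  "('a, 'e) mgraph \<Rightarrow> 'e set \<Rightarrow> 'a set set \<Rightarrow> 'e set \<Rightarrow> 'a set \<Rightarrow> nat \<Rightarrow> bool"
  for G T R A where
  "(\<And>u. u \<in> {u. \<exists>e. kernel_arc G T R u e v} \<Longrightarrow> kernel_label G T R A u (l u)) \<Longrightarrow>
   kernel_label G T R A v
     (card {e \<in> A. v \<in> ends G e} + (\<Sum>u \<in> {u. \<exists>e. kernel_arc G T R u e v}. l u))"

definition removal_part ::
  "'a set \<Rightarrow> ('a, 'e) mgraph \<Rightarrow> 'e set \<Rightarrow> 'a set set \<Rightarrow> 'e set \<Rightarrow> 'e set" where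
  "removal_part F G T R A =
     {e \<in> T. \<exists>u v l. kernel_arc G T R u e v \<and> u \<subseteq> F \<and> kernel_label G T R A u l \<and> odd l}"

text \<open>
  The argument \<open>A\<close> at level \<open>Suc k\<close> is also the set of edges of level \<open>k\<close> surviving to \<open>A\<close>,
  since surviving edges keep their identity.
\<close>

primrec cocycle_down_projection ::
  "'a set \<Rightarrow> (nat \<Rightarrow> ('a, 'e) mgraph) \<Rightarrow> (nat \<Rightarrow> 'e set) \<Rightarrow> (nat \<Rightarrow> 'a set set) \<Rightarrow>
   nat \<Rightarrow> 'e set \<Rightarrow> 'e set" where
  "cocycle_down_projection F G T R 0 A = A"
| "cocycle_down_projection F G T R (Suc k) A =
     cocycle_down_projection F G T R k (A \<union> removal_part F (G k) (T k) (R k) A)"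

end

theory Submission
  imports Defs
begin

text \<open>
  All edges are traced back to the base level. The edges \<open>C\<close> contracted in the dual graphs form a
  spanning tree of the dual of the pixel grid: a bridge or an edge of a forest lies on no cycle, and
  contraction turns cycles into cycles. Since every cycle of the pixel grid is a cut of the dual, which
  would have to meet \<open>C\<close>, the edges outside \<open>C\<close> form a forest. They consist of the edges \<open>U\<close> contracted in
  the primal graphs and of the edges that remain at the top; as the latter form a star with centre
  \<open>F\<close>, they are exactly the \<open>\<alpha> i\<close> and \<open>\<beta>\<close>.

  Consequently \<open>\<alpha> i\<close> projects down to the cut of the hole \<open>Hole i\<close>, which lies in \<open>C\<close> except for
  \<open>\<alpha> i\<close>, whereas \<open>{\<alpha> i, \<beta>}\<close> projects down to a cocycle inside \<open>{\<alpha> i, \<beta>} \<union> U\<close>. So these cycles and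
  cocycles are dual to each other, which yields blocking and independence. A cocycle orthogonal to
  all hole cuts is completed by background edges to a cycle of the pixel grid, hence is a dual cut,
  that is, a coboundary.
\<close>

section \<open>Parity\<close>

text \<open>Only level 0 is geometric. The higher \<open>G k\<close> and \<open>Gd k\<close> are
  treated as plain multigraphs, and no planar duality between them is carried along. Duality is
  therefore proved for the grid alone, in coordinates and in two halves: a mod 2 cycle of pixel
  edges is a dual cut (\<open>grid_cycle_is_dual_cut\<close>, by counting crossings of a ray), and a
  cut of the pixels is even at every interior grid point (\<open>grid_cut_even_at_corner\<close>).
  The pyramid contributes statements about edge sets only. That \<open>U\<close> together with the
  top edges is acyclic, and not just \<open>U\<close>, excludes loops and parallel edges at the top.
  Without loops the labels in the kernels count correctly; without parallel edges each hole hangs on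
  \<open>F\<close> by one edge only, so its cut can contain no second top edge.\<close>

lemma odd_card_sym_diff:
  assumes "finite A" "finite B"
  shows "odd (card (sym_diff A B)) \<longleftrightarrow> odd (card A) \<noteq> odd (card B)"
proof -
  have "card (sym_diff A B) = card (A - B) + card (B - A)"
    using assms by (intro card_Un_disjoint) auto
  moreover have "card A = card (A - B) + card (A \<inter> B)" "card B = card (B - A) + card (A \<inter> B)"
    using assms by (subst card_Un_disjoint[symmetric]; auto intro: arg_cong[of _ _ card])+
  ultimately show ?thesis by presburger
qed

lemma odd_card_Int_sym_diff:
  assumes "finite A"
  shows "odd (card (A \<inter> sym_diff X Y)) \<longleftrightarrow> odd (card (A \<inter> X)) \<noteq> odd (card (A \<inter> Y))"
proof -
  have "A \<inter> sym_diff X Y = sym_diff (A \<inter> X) (A \<inter> Y)" by blast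
  with odd_card_sym_diff[of "A \<inter> X" "A \<inter> Y"] assms show ?thesis by simp
qed

lemma mem_mod2_sum: "x \<in> mod2_sum c J \<longleftrightarrow> odd (card {i \<in> J. x \<in> c i})"
  by (simp add: mod2_sum_def)

lemma mod2_sum_empty [simp]: "mod2_sum c {} = {}"
  by (simp add: mod2_sum_def)

lemma mod2_sum_sym_diff:
  assumes "finite I" "finite J"
  shows "mod2_sum c (sym_diff I J) = sym_diff (mod2_sum c I) (mod2_sum c J)"
proof (intro set_eqI)
  fix x
  have "{i \<in> sym_diff I J. x \<in> c i} = sym_diff {i \<in> I. x \<in> c i} {i \<in> J. x \<in> c i}" by blast
  with odd_card_sym_diff[of "{i \<in> I. x \<in> c i}" "{i \<in> J. x \<in> c i}"] assms
  show "x \<in> mod2_sum c (sym_diff I J) \<longleftrightarrow> x \<in> sym_diff (mod2_sum c I) (mod2_sum c J)"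
    by (simp add: mem_mod2_sum) blast
qed

lemma mod2_sum_singleton [simp]: "mod2_sum c {j} = c j"
proof -
  have "{i \<in> {j}. x \<in> c i} = (if x \<in> c j then {j} else {})" for x by auto
  then show ?thesis by (auto simp: mod2_sum_def split: if_splits)
qed

lemma mod2_sum_insert:
  assumes "finite J" "j \<notin> J"
  shows "mod2_sum c (insert j J) = sym_diff (mod2_sum c J) (c j)"
  using mod2_sum_sym_diff[of J "{j}" c] assms
  by (simp add: Un_commute insert_Diff_if)

text \<open>Double counting of incidences between \<open>A\<close> and \<open>J\<close>. With
  \<open>bd1\<close>, \<open>bd2\<close>, \<open>ends G\<close> or the identity for \<open>c\<close>
  it serves as the Stokes formula, as the handshake lemma, and as a parity count on sets of
  pixels.\<close>

lemma odd_card_Int_mod2_sum: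
  assumes "finite A" "finite J"
  shows "odd (card (A \<inter> mod2_sum c J)) \<longleftrightarrow> odd (card {j \<in> J. odd (card (A \<inter> c j))})"
  using assms(2)
proof (induction J rule: finite_induct)
  case (insert j J)
  have "{i \<in> insert j J. odd (card (A \<inter> c i))} =
      (if odd (card (A \<inter> c j)) then insert j {i \<in> J. odd (card (A \<inter> c i))}
       else {i \<in> J. odd (card (A \<inter> c i))})" by auto
  with insert show ?case
    by (simp add: mod2_sum_insert odd_card_Int_sym_diff[OF assms(1)])
qed simp

lemma odd_card_Int_insert:
  assumes "finite B" "b \<notin> B"
  shows "odd (card (A \<inter> insert b B)) \<longleftrightarrow> (b \<in> A) \<noteq> odd (card (A \<inter> B))"
  using assms by (cases "b \<in> A") auto

lemma odd_card_Int_pair: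
  assumes "u \<noteq> v"
  shows "odd (card (A \<inter> {u, v})) \<longleftrightarrow> (u \<in> A) \<noteq> (v \<in> A)"
  using assms by (auto simp: odd_card_Int_insert)

section \<open>Contraction\<close>

definition wf_mgraph :: "('a, 'e) mgraph \<Rightarrow> bool" where
  "wf_mgraph G \<longleftrightarrow> finite (verts G) \<and> finite (edges G) \<and> {} \<notin> verts G \<and>
     (\<forall>u\<in>verts G. \<forall>v\<in>verts G. u \<inter> v \<noteq> {} \<longrightarrow> u = v) \<and>
     (\<forall>e\<in>edges G. \<exists>u\<in>verts G. \<exists>v\<in>verts G. ends G e = {u, v})"

lemma wf_mgraph_endsE:
  assumes "wf_mgraph G" "e \<in> edges G"
  obtains u v where "u \<in> verts G" "v \<in> verts G" "ends G e = {u, v}"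
  using assms unfolding wf_mgraph_def by meson

lemma wf_mgraph_finite:
  assumes "wf_mgraph G"
  shows "finite (verts G)" "finite (edges G)"
  using assms by (simp_all add: wf_mgraph_def)

lemma wf_mgraph_nonempty: "wf_mgraph G \<Longrightarrow> v \<in> verts G \<Longrightarrow> v \<noteq> {}"
  by (auto simp: wf_mgraph_def)

lemma wf_mgraph_disjoint:
  "wf_mgraph G \<Longrightarrow> u \<in> verts G \<Longrightarrow> v \<in> verts G \<Longrightarrow> x \<in> u \<Longrightarrow> x \<in> v \<Longrightarrow> u = v"
  unfolding wf_mgraph_def by (metis IntI empty_iff)

lemma wf_mgraph_ends_subset: "wf_mgraph G \<Longrightarrow> e \<in> edges G \<Longrightarrow> ends G e \<subseteq> verts G"
  by (auto elim: wf_mgraph_endsE)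

lemma joined_refl [simp]: "(u, u) \<in> joined G S"
  by (simp add: joined_def)

lemma joined_edge: "e \<in> S \<Longrightarrow> ends G e = {u, v} \<Longrightarrow> (u, v) \<in> joined G S"
  unfolding joined_def by blast

lemma joined_trans: "(u, v) \<in> joined G S \<Longrightarrow> (v, x) \<in> joined G S \<Longrightarrow> (u, x) \<in> joined G S"
  unfolding joined_def by (rule rtrancl_trans)

lemma joined_sym:
  assumes "(u, v) \<in> joined G S"
  shows "(v, u) \<in> joined G S"
proof -
  have "sym {(u, v). \<exists>e\<in>S. ends G e = {u, v}}" by (auto simp: sym_def insert_commute)
  then show ?thesis using assms unfolding joined_def by (meson sym_rtrancl symD)
qed

lemma joined_mono: "S \<subseteq> S' \<Longrightarrow> joined G S \<subseteq> joined G S'"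
  unfolding joined_def by (rule rtrancl_mono) blast

lemma joined_induct [consumes 1, case_names refl step]:
  assumes "(u, v) \<in> joined G S"
    and "P u"
    and "\<And>x y e. (u, x) \<in> joined G S \<Longrightarrow> P x \<Longrightarrow> e \<in> S \<Longrightarrow> ends G e = {x, y} \<Longrightarrow> P y"
  shows "P v"
  using assms(1) unfolding joined_def
proof (induction rule: rtrancl_induct)
  case (step y z)
  then show ?case using assms(3)[of y _ z] unfolding joined_def by blast
qed (rule assms(2))

lemma joined_verts:
  assumes "wf_mgraph G" "S \<subseteq> edges G" "u \<in> verts G" "(u, v) \<in> joined G S"
  shows "v \<in> verts G"
  using assms(4,3)
proof (induction rule: joined_induct)
  case (step x y e)
  then show ?case using wf_mgraph_ends_subset[OF assms(1), of e] assms(2) by auto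
qed

lemma mem_merged: "x \<in> merged G S v \<longleftrightarrow> (\<exists>u. (v, u) \<in> joined G S \<and> x \<in> u)"
  unfolding merged_def by blast

lemma joined_imp_merged_eq: "(u, v) \<in> joined G S \<Longrightarrow> merged G S u = merged G S v"
  unfolding merged_def using joined_trans joined_sym by (metis Image_singleton_iff subsetI subset_antisym)

lemma merged_overlap:
  assumes "wf_mgraph G" "S \<subseteq> edges G" "u \<in> verts G" "v \<in> verts G"
    and "x \<in> merged G S u" "x \<in> merged G S v"
  shows "(u, v) \<in> joined G S"
proof -
  obtain u' v' where *: "(u, u') \<in> joined G S" "x \<in> u'" "(v, v') \<in> joined G S" "x \<in> v'"
    using assms by (auto simp: mem_merged)
  then have "u' = v'"
    using assms joined_verts[OF assms(1,2)] wf_mgraph_disjoint[OF assms(1)] by blast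
  with * show ?thesis by (blast intro: joined_trans joined_sym)
qed

lemma merged_eq_iff:
  assumes "wf_mgraph G" "S \<subseteq> edges G" "u \<in> verts G" "v \<in> verts G"
  shows "merged G S u = merged G S v \<longleftrightarrow> (u, v) \<in> joined G S"
proof
  assume eq: "merged G S u = merged G S v"
  obtain x where "x \<in> u" using wf_mgraph_nonempty[OF assms(1,3)] by blast
  then have "x \<in> merged G S u" by (auto simp: mem_merged intro: exI[of _ u])
  with eq show "(u, v) \<in> joined G S" using merged_overlap[OF assms] by simp
qed (rule joined_imp_merged_eq)

lemma contract_simps [simp]:
  "verts (contract S G) = merged G S ` verts G"
  "edges (contract S G) = edges G - S"
  "ends (contract S G) e = merged G S ` ends G e"
  by (simp_all add: contract_def)

lemma remove_simps [simp]:
  "verts (remove S G) = verts G"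
  "edges (remove S G) = edges G - S"
  "ends (remove S G) = ends G"
  by (simp_all add: remove_def)

lemma joined_remove [simp]: "joined (remove X G) S = joined G S"
  by (simp add: joined_def)

lemma wf_mgraph_remove: "wf_mgraph G \<Longrightarrow> wf_mgraph (remove S G)"
  by (simp add: wf_mgraph_def)

lemma wf_mgraph_contract:
  assumes "wf_mgraph G" "S \<subseteq> edges G"
  shows "wf_mgraph (contract S G)"
  unfolding wf_mgraph_def
proof (intro conjI ballI impI)
  show "finite (verts (contract S G))" using assms(1) by (simp add: wf_mgraph_def)
  show "finite (edges (contract S G))" using assms(1) by (simp add: wf_mgraph_def)
  show "{} \<notin> verts (contract S G)"
  proof
    assume "{} \<in> verts (contract S G)"
    then obtain v where v: "v \<in> verts G" "merged G S v = {}" by auto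
    then obtain x where "x \<in> v" using wf_mgraph_nonempty[OF assms(1) v(1)] by blast
    then have "x \<in> merged G S v" unfolding mem_merged using joined_refl by blast
    then show False using v by simp
  qed
next
  fix U V assume UV: "U \<in> verts (contract S G)" "V \<in> verts (contract S G)" "U \<inter> V \<noteq> {}"
  then obtain u v where uv: "u \<in> verts G" "U = merged G S u" "v \<in> verts G" "V = merged G S v"
    by auto
  then obtain x where "x \<in> merged G S u" "x \<in> merged G S v" using UV(3) by blast
  then show "U = V"
    using joined_imp_merged_eq[OF merged_overlap[OF assms uv(1,3)]] uv by simp
next
  fix e assume "e \<in> edges (contract S G)"
  then have "e \<in> edges G" by simp
  from assms(1) this obtain u v where "u \<in> verts G" "v \<in> verts G" "ends G e = {u, v}"
    by (rule wf_mgraph_endsE)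
  then show "\<exists>u\<in>verts (contract S G). \<exists>v\<in>verts (contract S G). ends (contract S G) e = {u, v}"
    by (intro bexI[of _ "merged G S u"] bexI[of _ "merged G S v"]) auto
qed

definition crosses :: "('a, 'e) mgraph \<Rightarrow> 'a set set \<Rightarrow> 'e \<Rightarrow> bool" where
  "crosses G A e \<longleftrightarrow> ends G e \<inter> A \<noteq> {} \<and> ends G e - A \<noteq> {}"

text \<open>Cycles are phrased through cuts, since the cuts of a contraction are cuts of the graph.\<close>

definition even_cuts :: "('a, 'e) mgraph \<Rightarrow> 'e set \<Rightarrow> bool" where
  "even_cuts G z \<longleftrightarrow> (\<forall>A\<subseteq>verts G. even (card {e \<in> z. crosses G A e}))"

lemma even_cuts_remove [simp]: "even_cuts (remove S G) z \<longleftrightarrow> even_cuts G z"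
  by (simp add: even_cuts_def crosses_def)

text \<open>A vertex set of the contraction pulls back to a union \<open>B\<close> of merged
  classes. Contracted edges stay inside one class, so exactly the same edges of \<open>z\<close>
  cross both sets.\<close>

lemma even_cuts_contract:
  assumes "wf_mgraph G" "S \<subseteq> edges G" "z \<subseteq> edges G" "even_cuts G z"
  shows "even_cuts (contract S G) (z - S)"
  unfolding even_cuts_def
proof (intro allI impI)
  fix A assume "A \<subseteq> verts (contract S G)"
  define B where "B = {v \<in> verts G. merged G S v \<in> A}"
  have cross: "crosses (contract S G) A e \<longleftrightarrow> crosses G B e" if "e \<in> z" for e
    using wf_mgraph_ends_subset[OF assms(1), of e] that assms(3)
    unfolding crosses_def B_def by auto
  have not_S: "\<not> crosses G B e" if "e \<in> S" for e
  proof -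
    have "e \<in> edges G" using that assms by blast
    from assms(1) this obtain u v where uv: "u \<in> verts G" "v \<in> verts G" "ends G e = {u, v}"
      by (rule wf_mgraph_endsE)
    then have "merged G S u = merged G S v"
      using that by (intro joined_imp_merged_eq joined_edge)
    with uv show ?thesis unfolding crosses_def B_def by auto
  qed
  have "{e \<in> z - S. crosses (contract S G) A e} = {e \<in> z. crosses G B e}"
    using cross not_S by blast
  then show "even (card {e \<in> z - S. crosses (contract S G) A e})"
    using assms(4) unfolding even_cuts_def B_def by simp
qed

text \<open>The part of \<open>X - {e}\<close> reachable from \<open>u\<close> defines a cut that
  \<open>e\<close> alone crosses. The ambient set \<open>X\<close> is a forest in one application
  and all of \<open>edges G\<close> in the other, where pendant edges are bridges of the whole
  graph.\<close>

lemma bridge_not_even_cuts: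
  assumes "wf_mgraph G" "X \<subseteq> edges G" "z \<subseteq> X" "e \<in> z" "ends G e = {u, v}"
    and "(u, v) \<notin> joined G (X - {e})"
  shows "\<not> even_cuts G z"
proof
  assume even: "even_cuts G z"
  define A where "A = joined G (X - {e}) `` {u}"
  have "e \<in> edges G" using assms(2-4) by auto
  then have "u \<in> verts G"
    using wf_mgraph_ends_subset[OF assms(1), of e] assms(5) by simp
  then have A: "A \<subseteq> verts G"
    using joined_verts[OF assms(1), of "X - {e}" u] assms(2) unfolding A_def by auto
  have "\<not> crosses G A e'" if e': "e' \<in> z" "e' \<noteq> e" for e'
  proof -
    have "e' \<in> edges G" using e' assms(2,3) by auto
    from assms(1) this obtain a b where ab: "ends G e' = {a, b}" by (rule wf_mgraph_endsE)
    have "(a, b) \<in> joined G (X - {e})" using e' assms(3) by (intro joined_edge[OF _ ab]) auto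
    then have "a \<in> A \<longleftrightarrow> b \<in> A"
      unfolding A_def using joined_trans joined_sym by (metis Image_singleton_iff)
    with ab show ?thesis by (auto simp: crosses_def)
  qed
  moreover have "crosses G A e" using assms(5,6) by (auto simp: crosses_def A_def)
  ultimately have "{e' \<in> z. crosses G A e'} = {e}" using assms(4) by auto
  with even A have "even (card {e})" unfolding even_cuts_def by metis
  then show False by simp
qed

lemma forest_no_even_cuts:
  assumes "wf_mgraph G" "forest G X" "z \<subseteq> X" "even_cuts G z"
  shows "z = {}"
proof (rule ccontr)
  assume "z \<noteq> {}"
  then obtain e where e: "e \<in> z" by blast
  then have "e \<in> edges G" using assms by (auto simp: forest_def)
  from assms(1) this obtain u v where uv: "ends G e = {u, v}" by (rule wf_mgraph_endsE)
  have "e \<in> X" using e assms(3) by blast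
  with uv assms(2) have "(u, v) \<notin> joined G (X - {e})" by (simp add: forest_def)
  moreover have "X \<subseteq> edges G" using assms by (simp add: forest_def)
  ultimately have "\<not> even_cuts G z" by (intro bridge_not_even_cuts[OF assms(1) _ assms(3) e uv])
  then show False using assms(4) by simp
qed

lemma pendant_edges_subset: "pendant_edges G \<subseteq> edges G"
  by (auto simp: pendant_edges_def)

lemma pendant_no_even_cuts:
  assumes "wf_mgraph G" "z \<subseteq> pendant_edges G" "even_cuts G z"
  shows "z = {}"
proof (rule ccontr)
  assume "z \<noteq> {}"
  then obtain e where e: "e \<in> z" by blast
  then have "e \<in> pendant_edges G" using assms(2) by blast
  then obtain u v where uv: "ends G e = {u, v}" "(u, v) \<notin> joined G (edges G - {e})"
    by (auto simp: pendant_edges_def)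
  have "z \<subseteq> edges G" using assms(2) pendant_edges_subset[of G] by blast
  then have "\<not> even_cuts G z" by (rule bridge_not_even_cuts[OF assms(1) order_refl _ e uv])
  then show False using assms(3) by simp
qed

definition connected_by :: "('a, 'e) mgraph \<Rightarrow> 'e set \<Rightarrow> bool" where
  "connected_by G X \<longleftrightarrow> (\<forall>u\<in>verts G. \<forall>v\<in>verts G. (u, v) \<in> joined G X)"

lemma connected_by_remove [simp]: "connected_by (remove S G) X \<longleftrightarrow> connected_by G X"
  by (simp add: connected_by_def)

text \<open>A walk in the contraction lifts to the graph: each edge of \<open>X\<close> is used as
  it is, and the gaps between consecutive edges are bridged inside a merged class by
  \<open>S\<close>.\<close>

lemma connected_by_contract:
  assumes "wf_mgraph G" "S \<subseteq> edges G" "X \<subseteq> edges G" "connected_by (contract S G) X"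
  shows "connected_by G (S \<union> X)"
  unfolding connected_by_def
proof (intro ballI)
  fix u v assume u: "u \<in> verts G" and v: "v \<in> verts G"
  have "(merged G S u, merged G S v) \<in> joined (contract S G) X"
    using assms(4) u v by (simp add: connected_by_def)
  \<comment> \<open>The invariant covers all representatives of the class reached, since the next
    edge may leave the class at a different vertex from the one where it was entered.\<close>
  then have "\<forall>x\<in>verts G. merged G S x = merged G S v \<longrightarrow> (u, x) \<in> joined G (S \<union> X)"
  proof (induction rule: joined_induct)
    case refl
    show ?case
    proof (intro ballI impI)
      fix x assume "x \<in> verts G" "merged G S x = merged G S u"
      then have "(u, x) \<in> joined G S" using merged_eq_iff[OF assms(1,2) u] by metis
      then show "(u, x) \<in> joined G (S \<union> X)" using joined_mono[of S "S \<union> X" G] by blast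
    qed
  next
    case (step V W e)
    have "e \<in> edges G" using step assms by blast
    from assms(1) this obtain a b where ab: "a \<in> verts G" "b \<in> verts G" "ends G e = {a, b}"
      by (rule wf_mgraph_endsE)
    have "{merged G S a, merged G S b} = {V, W}"
      using \<open>ends (contract S G) e = {V, W}\<close> ab(3) by simp
    then consider "merged G S a = V" "merged G S b = W" | "merged G S b = V" "merged G S a = W"
      by (metis doubleton_eq_iff)
    then obtain a' b' where ab': "a' \<in> verts G" "b' \<in> verts G" "ends G e = {a', b'}"
        "merged G S a' = V" "merged G S b' = W"
      using ab by cases (auto simp: insert_commute)
    have "(u, a') \<in> joined G (S \<union> X)" using step ab' by blast
    moreover have "(a', b') \<in> joined G (S \<union> X)" using ab' step by (intro joined_edge) auto
    ultimately have "(u, b') \<in> joined G (S \<union> X)" by (rule joined_trans)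
    moreover have "(b', x) \<in> joined G (S \<union> X)" if "x \<in> verts G" "merged G S x = W" for x
      using merged_eq_iff[OF assms(1,2) ab'(2) that(1)] that ab' joined_mono[of S "S \<union> X" G] by auto
    ultimately show ?case using joined_trans by fast
  qed
  then show "(u, v) \<in> joined G (S \<union> X)" using v by blast
qed

section \<open>The pixel grid\<close>

lemma base_edges_iff:
  "e \<in> base_edges w h \<longleftrightarrow>
     (\<exists>i j. Suc i < w \<and> j < h \<and> e = {(i, j), (Suc i, j)}) \<or>
     (\<exists>i j. i < w \<and> Suc j < h \<and> e = {(i, j), (i, Suc j)})"
proof
  assume "e \<in> base_edges w h"
  then obtain i j i' j' where "e = {(i, j), (i', j')}" "(i, j) \<in> pixels w h" "(i', j') \<in> pixels w h"
    "((i, j), (i', j')) \<in> adj4"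
    unfolding base_edges_def by fast
  then show "(\<exists>i j. Suc i < w \<and> j < h \<and> e = {(i, j), (Suc i, j)}) \<or>
     (\<exists>i j. i < w \<and> Suc j < h \<and> e = {(i, j), (i, Suc j)})"
    by (auto simp: adj4_def pixels_def insert_commute)
next
  assume "(\<exists>i j. Suc i < w \<and> j < h \<and> e = {(i, j), (Suc i, j)}) \<or>
     (\<exists>i j. i < w \<and> Suc j < h \<and> e = {(i, j), (i, Suc j)})"
  then show "e \<in> base_edges w h"
    unfolding base_edges_def by (fastforce simp: adj4_def pixels_def)
qed

lemma horizontal_edge: "Suc i < w \<Longrightarrow> j < h \<Longrightarrow> {(i, j), (Suc i, j)} \<in> base_edges w h"
  unfolding base_edges_iff by blast

lemma vertical_edge: "i < w \<Longrightarrow> Suc j < h \<Longrightarrow> {(i, j), (i, Suc j)} \<in> base_edges w h"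
  unfolding base_edges_iff by blast

lemma base_edgesE:
  assumes "e \<in> base_edges w h"
  obtains p q where "e = {p, q}" "p \<noteq> q" "p \<in> pixels w h" "q \<in> pixels w h" "(p, q) \<in> adj4"
  using assms unfolding base_edges_def adj4_def by auto

text \<open>Natural subtraction turns \<open>{(i - 1, j), (i, j)}\<close> into a singleton at i = 0.
  This fact makes such a degenerate expression count as an absent edge.\<close>

lemma singleton_not_base_edge: "{p} \<notin> base_edges w h"
proof
  assume "{p} \<in> base_edges w h"
  then obtain a b where "{p} = {a, b}" "a \<noteq> b" by (rule base_edgesE)
  then show False by auto
qed

lemma adj4_sym: "(p, q) \<in> adj4 \<Longrightarrow> (q, p) \<in> adj4"
  by (auto simp: adj4_def)

lemma finite_pixels [simp]: "finite (pixels w h)"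
  by (simp add: pixels_def)

lemma base_edges_subset_pixels: "e \<in> base_edges w h \<Longrightarrow> e \<subseteq> pixels w h"
  by (auto elim: base_edgesE)

lemma finite_base_edges [simp]: "finite (base_edges w h)"
proof (rule finite_subset)
  show "base_edges w h \<subseteq> Pow (pixels w h)" using base_edges_subset_pixels by blast
qed simp

lemma odd_card_Int_base_edge:
  assumes "e \<in> base_edges w h"
  shows "odd (card (A \<inter> e)) \<longleftrightarrow> e \<inter> A \<noteq> {} \<and> e - A \<noteq> {}"
  by (rule base_edgesE[OF assms]) (auto simp: odd_card_Int_pair)

text \<open>The two ends of the dual edge as plain grid points, before \<open>dual_vertex\<close>
  collapses the rim.\<close>

abbreviation sides :: "edge \<Rightarrow> point set" where
  "sides e \<equiv> \<Inter>p\<in>e. corners p"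

lemma sides_horizontal: "sides {(i, j), (Suc i, j)} = {(Suc i, j), (Suc i, Suc j)}"
  by (auto simp: corners_def)

lemma sides_vertical: "sides {(i, j), (i, Suc j)} = {(i, Suc j), (Suc i, Suc j)}"
  by (auto simp: corners_def)

text \<open>The nested disequalities form the mod 2 sum over the left, right, lower and upper edge
  of the pixel. A missing neighbour on the border contributes \<open>False\<close>.\<close>

lemma even_at_pixel:
  assumes "z \<subseteq> base_edges w h"
  shows "(i, j) \<in> mod2_sum (\<lambda>e. e) z \<longleftrightarrow>
    ((({(i - 1, j), (i, j)} \<in> z) \<noteq> ({(i, j), (Suc i, j)} \<in> z)) \<noteq>
    (({(i, j - 1), (i, j)} \<in> z) \<noteq> ({(i, j), (i, Suc j)} \<in> z)))"
proof -
  let ?l = "{(i - 1, j), (i, j)}" and ?r = "{(i, j), (Suc i, j)}"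
  let ?d = "{(i, j - 1), (i, j)}" and ?u = "{(i, j), (i, Suc j)}"
  have loop: "{p} \<notin> z" for p
    using assms singleton_not_base_edge by blast
  have l: "i > 0" if "?l \<in> z" using that loop by (cases i) auto
  have d: "j > 0" if "?d \<in> z" using that loop by (cases j) auto
  have "{e \<in> z. (i, j) \<in> e} \<subseteq> z \<inter> {?l, ?r, ?d, ?u}"
  proof
    fix e assume e: "e \<in> {e \<in> z. (i, j) \<in> e}"
    then have ez: "e \<in> z" and eb: "e \<in> base_edges w h" and p: "(i, j) \<in> e"
      using assms by auto
    from eb consider a b where "e = {(a, b), (Suc a, b)}" | a b where "e = {(a, b), (a, Suc b)}"
      unfolding base_edges_iff by blast
    then have "e \<in> {?l, ?r, ?d, ?u}"
    proof cases
      case 1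
      then have "(i, j) = (a, b) \<or> (i, j) = (Suc a, b)" using p by simp
      then have "e = ?r \<or> e = ?l" using 1 by (elim disjE) simp_all
      then show ?thesis by (elim disjE) simp_all
    next
      case 2
      then have "(i, j) = (a, b) \<or> (i, j) = (a, Suc b)" using p by simp
      then have "e = ?u \<or> e = ?d" using 2 by (elim disjE) simp_all
      then show ?thesis by (elim disjE) simp_all
    qed
    with ez show "e \<in> z \<inter> {?l, ?r, ?d, ?u}" by (rule IntI)
  qed
  moreover have "z \<inter> {?l, ?r, ?d, ?u} \<subseteq> {e \<in> z. (i, j) \<in> e}" by auto
  ultimately have eq: "{e \<in> z. (i, j) \<in> e} = z \<inter> {?l, ?r, ?d, ?u}" by (rule subset_antisym)
  \<comment> \<open>Some distinctness holds only for edges present in \<open>z\<close>: at (0, 0),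
    for instance, \<open>?l\<close> and \<open>?d\<close> are the same singleton.\<close>
  have dist: "?r \<noteq> ?u" "?l \<in> z \<Longrightarrow> ?l \<noteq> ?r" "?l \<in> z \<Longrightarrow> ?l \<noteq> ?d" "?l \<in> z \<Longrightarrow> ?l \<noteq> ?u"
     "?d \<in> z \<Longrightarrow> ?d \<noteq> ?r" "?d \<in> z \<Longrightarrow> ?d \<noteq> ?u"
    using l d by (auto simp: doubleton_eq_iff)
  have "odd (card (z \<inter> {?l, ?r, ?d, ?u})) \<longleftrightarrow>
     (((?l \<in> z) \<noteq> (?r \<in> z)) \<noteq> ((?d \<in> z) \<noteq> (?u \<in> z)))"
    using dist by (cases "?l \<in> z"; cases "?r \<in> z"; cases "?d \<in> z"; cases "?u \<in> z") simp_all
  then show ?thesis unfolding mem_mod2_sum eq .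
qed

text \<open>Whether the cycle \<open>z\<close> encloses a grid point, by counting the edges met on the ray going down from it.\<close>

definition ray_parity :: "edge set \<Rightarrow> point \<Rightarrow> bool" where
  "ray_parity z = (\<lambda>(x, y). odd (card {j. j < y \<and> {(x - 1, j), (x, j)} \<in> z}))"

lemma ray_parity_0: "\<not> ray_parity z (x, 0)"
  by (simp add: ray_parity_def)

lemma ray_parity_Suc:
  "ray_parity z (x, Suc y) \<longleftrightarrow> ray_parity z (x, y) \<noteq> ({(x - 1, y), (x, y)} \<in> z)"
proof -
  have "{j. j < Suc y \<and> {(x - 1, j), (x, j)} \<in> z} =
    (if {(x - 1, y), (x, y)} \<in> z then insert y {j. j < y \<and> {(x - 1, j), (x, j)} \<in> z}
     else {j. j < y \<and> {(x - 1, j), (x, j)} \<in> z})"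
    by (auto simp: less_Suc_eq)
  then show ?thesis by (simp add: ray_parity_def)
qed

text \<open>Add up the evenness conditions at the pixels (i, 0), ..., (i, j). The horizontal edges
  give the two ray counts, the inner vertical edges cancel, and only the topmost vertical edge is
  left. That edge separates the two grid points compared.\<close>

lemma ray_parity_step:
  assumes "z \<subseteq> base_edges w h" "mod2_sum (\<lambda>e. e) z = {}"
  shows "ray_parity z (i, Suc j) \<noteq> ray_parity z (Suc i, Suc j) \<longleftrightarrow> {(i, j), (i, Suc j)} \<in> z"
proof (induction j)
  case 0
  have "{(i, 0)} \<notin> z" using assms(1) singleton_not_base_edge by blast
  then show ?case using even_at_pixel[OF assms(1), of i 0] assms(2)
    by (simp add: ray_parity_Suc ray_parity_0)
next
  case (Suc j)
  then show ?case using even_at_pixel[OF assms(1), of i "Suc j"] assms(2)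
    by (simp add: ray_parity_Suc[of z _ "Suc j"]) blast
qed

text \<open>Nothing outside the open rectangle is enclosed. This keeps the unbounded face on one
  side of the cut, so collapsing the rim to one dual vertex does no harm.\<close>

lemma ray_parity_rim:
  assumes "z \<subseteq> base_edges w h" "mod2_sum (\<lambda>e. e) z = {}" "ray_parity z (x, y)"
  shows "0 < x \<and> x < w \<and> 0 < y \<and> y < h"
proof -
  have "0 < x"
  proof (rule ccontr)
    assume "\<not> 0 < x"
    moreover have "{(0, j)} \<notin> z" for j
      using assms(1) singleton_not_base_edge by blast
    ultimately show False using assms(3) by (simp add: ray_parity_def)
  qed
  moreover have "x < w"
  proof (rule ccontr)
    assume "\<not> x < w"
    then have "{(x - 1, j), (x, j)} \<notin> z" for j
      using assms(1) base_edges_subset_pixels by (fastforce simp: pixels_def)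
    then show False using assms(3) by (simp add: ray_parity_def)
  qed
  moreover have "0 < y" using assms(3) ray_parity_0[of z x] by (cases y) auto
  moreover have "y < h"
  proof (rule ccontr)
    assume y: "\<not> y < h"
    then obtain j where j: "y = Suc j" using \<open>0 < y\<close> by (cases y) auto
    have "{(i, j), (i, y)} \<notin> z" for i
      using assms(1) y base_edges_subset_pixels by (fastforce simp: pixels_def)
    \<comment> \<open>Above the top row a step to the right crosses no edge, so the parity equals
      that at column 0, where every expression counted is a singleton.\<close>
    then have "ray_parity z (i, y) = ray_parity z (Suc i, y)" for i
      using ray_parity_step[OF assms(1,2), of i j] j by blast
    then have "ray_parity z (i, y) = ray_parity z (0, y)" for i
      by (induction i) auto
    moreover have "{(0, j)} \<notin> z" for j
      using assms(1) singleton_not_base_edge by blast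
    then have "\<not> ray_parity z (0, y)" by (simp add: ray_parity_def)
    ultimately show False using assms(3) by blast
  qed
  ultimately show ?thesis by blast
qed

text \<open>The set \<open>A\<close> consists of the enclosed grid points. Horizontal edges of
  \<open>z\<close> are detected by lengthening the ray by one, vertical ones by shifting it to the
  next column.\<close>

lemma grid_cycle_is_dual_cut:
  assumes "z \<subseteq> base_edges w h" "mod2_sum (\<lambda>e. e) z = {}"
  obtains A where "A \<subseteq> {0<..<w} \<times> {0<..<h}"
    "\<And>e. e \<in> base_edges w h \<Longrightarrow> e \<in> z \<longleftrightarrow> odd (card (A \<inter> sides e))"
proof
  let ?A = "{c. ray_parity z c}"
  show "?A \<subseteq> {0<..<w} \<times> {0<..<h}" using ray_parity_rim[OF assms] by auto
  fix e assume "e \<in> base_edges w h"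
  then consider i j where "e = {(i, j), (Suc i, j)}" | i j where "e = {(i, j), (i, Suc j)}"
    unfolding base_edges_iff by blast
  then show "e \<in> z \<longleftrightarrow> odd (card (?A \<inter> sides e))"
  proof cases
    case 1
    then show ?thesis
      unfolding 1 sides_horizontal
      by (simp add: odd_card_Int_pair ray_parity_Suc) blast
  next
    case 2
    then show ?thesis
      unfolding 2 sides_vertical using ray_parity_step[OF assms, of i j]
      by (simp add: odd_card_Int_pair)
  qed
qed

text \<open>The four pixels around an interior grid point form a closed 4-cycle, and membership in
  \<open>X\<close> changes an even number of times around a cycle.\<close>

lemma grid_cut_even_at_corner:
  assumes "0 < x" "x < w" "0 < y" "y < h"
  shows "even (card {e \<in> base_edges w h. (x, y) \<in> sides e \<and> odd (card (X \<inter> e))})"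
proof -
  obtain i j where xy: "x = Suc i" "y = Suc j" using assms by (metis gr0_conv_Suc)
  let ?e1 = "{(i, j), (Suc i, j)}" and ?e2 = "{(i, Suc j), (Suc i, Suc j)}"
  let ?e3 = "{(i, j), (i, Suc j)}" and ?e4 = "{(Suc i, j), (Suc i, Suc j)}"
  have "{e \<in> base_edges w h. (x, y) \<in> sides e} = {?e1, ?e2, ?e3, ?e4}"
  proof
    show "{e \<in> base_edges w h. (x, y) \<in> sides e} \<subseteq> {?e1, ?e2, ?e3, ?e4}"
    proof
      fix e assume e: "e \<in> {e \<in> base_edges w h. (x, y) \<in> sides e}"
      then have "e \<in> base_edges w h" and c: "(x, y) \<in> sides e" by auto
      then consider a b where "e = {(a, b), (Suc a, b)}" | a b where "e = {(a, b), (a, Suc b)}"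
        unfolding base_edges_iff by blast
      then show "e \<in> {?e1, ?e2, ?e3, ?e4}"
      proof cases
        case 1
        then have "(x, y) \<in> {(Suc a, b), (Suc a, Suc b)}" using c sides_horizontal by metis
        then have "a = i \<and> (b = Suc j \<or> b = j)" using xy by auto
        then have "e = ?e2 \<or> e = ?e1" using 1 by (elim conjE disjE) simp_all
        then show ?thesis by (elim disjE) simp_all
      next
        case 2
        then have "(x, y) \<in> {(a, Suc b), (Suc a, Suc b)}" using c sides_vertical by metis
        then have "b = j \<and> (a = Suc i \<or> a = i)" using xy by auto
        then have "e = ?e4 \<or> e = ?e3" using 2 by (elim conjE disjE) simp_all
        then show ?thesis by (elim disjE) simp_all
      qed
    qed
    have "?e1 \<in> base_edges w h" "?e2 \<in> base_edges w h" "?e3 \<in> base_edges w h" "?e4 \<in> base_edges w h"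
      using assms xy by (auto intro: horizontal_edge vertical_edge)
    moreover have "(x, y) \<in> sides ?e1" "(x, y) \<in> sides ?e2" "(x, y) \<in> sides ?e3" "(x, y) \<in> sides ?e4"
      unfolding sides_horizontal sides_vertical xy by simp_all
    ultimately show "{?e1, ?e2, ?e3, ?e4} \<subseteq> {e \<in> base_edges w h. (x, y) \<in> sides e}" by simp
  qed
  moreover have "{e \<in> base_edges w h. (x, y) \<in> sides e \<and> odd (card (X \<inter> e))} =
      {e. odd (card (X \<inter> e))} \<inter> {e \<in> base_edges w h. (x, y) \<in> sides e}"
    by (simp only: Int_def mem_Collect_eq conj_ac)
  ultimately have eq: "{e \<in> base_edges w h. (x, y) \<in> sides e \<and> odd (card (X \<inter> e))} =
      {e. odd (card (X \<inter> e))} \<inter> {?e1, ?e2, ?e3, ?e4}" by (simp only:)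
  have dist: "?e1 \<noteq> ?e2" "?e1 \<noteq> ?e3" "?e1 \<noteq> ?e4" "?e2 \<noteq> ?e3" "?e2 \<noteq> ?e4" "?e3 \<noteq> ?e4"
    by (auto simp: doubleton_eq_iff)
  have m: "odd (card (X \<inter> ?e1)) \<longleftrightarrow> ((i, j) \<in> X) \<noteq> ((Suc i, j) \<in> X)"
     "odd (card (X \<inter> ?e2)) \<longleftrightarrow> ((i, Suc j) \<in> X) \<noteq> ((Suc i, Suc j) \<in> X)"
     "odd (card (X \<inter> ?e3)) \<longleftrightarrow> ((i, j) \<in> X) \<noteq> ((i, Suc j) \<in> X)"
     "odd (card (X \<inter> ?e4)) \<longleftrightarrow> ((Suc i, j) \<in> X) \<noteq> ((Suc i, Suc j) \<in> X)"
    by (simp_all add: odd_card_Int_pair)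
  have "odd (card ({e. odd (card (X \<inter> e))} \<inter> {?e1, ?e2, ?e3, ?e4})) \<longleftrightarrow>
     (odd (card (X \<inter> ?e1)) \<noteq> (odd (card (X \<inter> ?e2)) \<noteq> (odd (card (X \<inter> ?e3)) \<noteq> odd (card (X \<inter> ?e4)))))"
    using dist by (subst odd_card_Int_insert; simp add: odd_card_Int_insert del: Int_insert_right)
  then show ?thesis unfolding eq m by argo
qed

section \<open>Paths and regions\<close>

text \<open>The edges of a walk are added mod 2, so repeated edges cancel and no simple path has to
  be extracted.\<close>

lemma rtrancl_edge_chain:
  assumes "(p, q) \<in> {(a, b). a \<noteq> b \<and> {a, b} \<in> Y}\<^sup>*"
  obtains x where "finite x" "x \<subseteq> Y" "mod2_sum (\<lambda>e. e) x = sym_diff {p} {q}"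
  using assms
proof (induction arbitrary: thesis rule: rtrancl_induct)
  case base
  show ?case by (rule base[of "{}"]) auto
next
  case (step q r)
  from step(3) obtain x where x: "finite x" "x \<subseteq> Y" "mod2_sum (\<lambda>e. e) x = sym_diff {p} {q}" .
  show ?case
  proof (rule step(4))
    show "finite (sym_diff x {{q, r}})" "sym_diff x {{q, r}} \<subseteq> Y" using x step(2) by auto
    show "mod2_sum (\<lambda>e. e) (sym_diff x {{q, r}}) = sym_diff {p} {r}"
      using x step(2) by (subst mod2_sum_sym_diff) auto
  qed
qed

lemma region_refl: "p \<in> region X p"
  by (simp add: region_def)

lemma region_subset: "p \<in> X \<Longrightarrow> region X p \<subseteq> X"
  unfolding region_def by (auto elim: rtranclE)

lemma region_eq:
  assumes "q \<in> region X p"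
  shows "region X q = region X p"
proof -
  have "sym (Restr adj4 X)" by (auto simp: sym_def adj4_sym)
  then have "(q, p) \<in> (Restr adj4 X)\<^sup>*"
    using assms unfolding region_def by (metis Image_singleton_iff sym_rtrancl symD)
  then show ?thesis using assms unfolding region_def by (auto intro: rtrancl_trans)
qed

lemma region_step:
  assumes "p \<in> region X p0" "(p, q) \<in> adj4" "p \<in> X" "q \<in> X"
  shows "q \<in> region X p0"
  using assms unfolding region_def by (auto intro: rtrancl_into_rtrancl)

section \<open>Labels in contraction kernels\<close>

text \<open>After its last passage through \<open>e\<close> the walk avoids \<open>e\<close>, and
  this tail starts at \<open>u\<close> or at \<open>v\<close>.\<close>

lemma joined_delete:
  assumes "(x, r) \<in> joined G X" "ends G e = {u, v}"
  shows "(x, r) \<in> joined G (X - {e}) \<or> (u, r) \<in> joined G (X - {e}) \<or> (v, r) \<in> joined G (X - {e})"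
  using assms(1)
proof (induction rule: joined_induct)
  case (step y z e')
  show ?case
  proof (cases "e' = e")
    case True
    then have "z = u \<or> z = v" using step.hyps assms(2) by (auto simp: doubleton_eq_iff)
    then show ?thesis by auto
  next
    case False
    then have "(y, z) \<in> joined G (X - {e})"
      using step.hyps by (intro joined_edge[of e']) auto
    then show ?thesis using step.IH by (elim disjE) (simp_all add: joined_trans)
  qed
qed simp

text \<open>A walk that uses \<open>e\<close> visits \<open>u\<close>, and its remainder joins
  \<open>u\<close> to \<open>r\<close>, possibly through \<open>e\<close> again.\<close>

lemma joined_delete':
  assumes "(x, r) \<in> joined G X" "ends G e = {u, v}"
  shows "(x, r) \<in> joined G (X - {e}) \<or> (u, r) \<in> joined G X"
  using assms(1)
proof (induction rule: joined_induct)
  case (step y z e')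
  show ?case
  proof (cases "e' = e")
    case True
    then have "z = u \<or> (u, z) \<in> joined G X"
      using step.hyps assms(2) joined_edge[OF step.hyps(2) step.hyps(3)]
        joined_edge[OF step.hyps(2), of G u v] by (auto simp: doubleton_eq_iff)
    then show ?thesis by auto
  next
    case False
    then have "(y, z) \<in> joined G (X - {e})"
      using step.hyps by (intro joined_edge[of e']) auto
    moreover have "(y, z) \<in> joined G X" using step.hyps by (intro joined_edge[of e']) auto
    ultimately show ?thesis using step.IH by (elim disjE) (simp_all add: joined_trans)
  qed
qed simp

locale kernels =
  fixes F :: "'a set" and G :: "('a, 'e) mgraph" and T :: "'e set" and R :: "'a set set"
  assumes wf: "wf_mgraph G" and kernels: "contraction_kernels F G T R"
begin

abbreviation "arc \<equiv> kernel_arc G T R"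
abbreviation "arcs \<equiv> {(u, v). \<exists>e. arc u e v}"

lemma T_forest: "forest G T"
  using kernels by (simp add: contraction_kernels_def)

lemma T_subset: "T \<subseteq> edges G"
  using T_forest by (simp add: forest_def)

lemma finite_T: "finite T"
  using T_subset wf_mgraph_finite(2)[OF wf] by (rule finite_subset)

lemma ex1_root: "v \<in> verts G \<Longrightarrow> \<exists>!r. r \<in> R \<and> (v, r) \<in> joined G T"
  using kernels by (simp add: contraction_kernels_def)

lemma T_cut: "e \<in> T \<Longrightarrow> ends G e = {u, v} \<Longrightarrow> (u, v) \<notin> joined G (T - {e})"
  using T_forest by (simp add: forest_def)

lemma T_no_loop: "e \<in> T \<Longrightarrow> ends G e = {u, v} \<Longrightarrow> u \<noteq> v"
  using T_cut joined_refl by metis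

lemma joined_same_label:
  assumes "(u, v) \<in> joined G T"
  shows "u \<subseteq> F \<longleftrightarrow> v \<subseteq> F"
  using assms
proof (induction rule: joined_induct)
  case (step x y e)
  then have "x \<subseteq> F \<longleftrightarrow> y \<subseteq> F"
    using kernels unfolding contraction_kernels_def by (metis insertCI)
  with step.IH show ?case by simp
qed simp

lemma joined_T_delete: "(u, v) \<in> joined G (T - {e}) \<Longrightarrow> (u, v) \<in> joined G T"
  using joined_mono[of "T - {e}" T G] by auto

lemma arcD:
  assumes "arc u e v"
  shows "e \<in> T" "ends G e = {u, v}" "u \<noteq> v" "u \<in> verts G" "v \<in> verts G" "(u, v) \<in> joined G T"
proof -
  show *: "e \<in> T" "ends G e = {u, v}" "u \<noteq> v" using assms by (simp_all add: kernel_arc_def)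
  then show "u \<in> verts G" "v \<in> verts G"
    using wf_mgraph_ends_subset[OF wf, of e] T_subset by auto
  show "(u, v) \<in> joined G T" using * joined_edge by metis
qed

text \<open>\<open>kernel_arc\<close> only asks for some root on the side of \<open>v\<close>.
  Uniqueness of the root in a kernel identifies it with the root of \<open>u\<close>.\<close>

lemma arc_root:
  assumes "arc u e v" "r \<in> R" "(u, r) \<in> joined G T"
  shows "(v, r) \<in> joined G (T - {e})"
proof -
  obtain r' where r': "r' \<in> R" "(v, r') \<in> joined G (T - {e})"
    using assms(1) by (auto simp: kernel_arc_def)
  then have "(u, r') \<in> joined G T" using arcD[OF assms(1)] joined_T_delete joined_trans by metis
  then have "r' = r" using ex1_root[of u] arcD[OF assms(1)] assms(2,3) r'(1) by blast
  with r' show ?thesis by simp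
qed

lemma root_no_arc:
  assumes "r \<in> R"
  shows "\<not> arc r e v"
proof
  assume "arc r e v"
  then have "(v, r) \<in> joined G (T - {e})" using arc_root[OF _ assms] by simp
  then show False using T_cut arcD(1,2)[OF \<open>arc r e v\<close>] joined_sym by metis
qed

lemma arc_asym:
  assumes "arc u e v" "arc v e u"
  shows False
proof -
  obtain r where r: "r \<in> R" "(u, r) \<in> joined G T" using ex1_root arcD(4)[OF assms(1)] by blast
  then have "(v, r) \<in> joined G T" using arcD(6)[OF assms(2)] joined_trans by metis
  then have "(v, r) \<in> joined G (T - {e})" "(u, r) \<in> joined G (T - {e})"
    using arc_root[OF assms(1) r] arc_root[OF assms(2) r(1)] by simp_all
  then show False using T_cut[OF arcD(1,2)[OF assms(1)]] joined_sym joined_trans by metis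
qed

text \<open>The walk from \<open>v\<close> to the root that avoids \<open>e\<close> also avoids a
  second arc \<open>e'\<close> out of \<open>u\<close>, as it would otherwise pass \<open>u\<close>,
  which is cut off from the root without \<open>e\<close>. Going along \<open>e\<close> to the root
  and back to \<open>v'\<close> then joins the ends of \<open>e'\<close> without \<open>e'\<close>,
  contrary to the forest property.\<close>

lemma arc_edge_unique:
  assumes "arc u e v" "arc u e' v'"
  shows "e = e'"
proof (rule ccontr)
  assume neq: "e \<noteq> e'"
  obtain r where r: "r \<in> R" "(u, r) \<in> joined G T" using ex1_root arcD(4)[OF assms(1)] by blast
  note v = arc_root[OF assms(1) r] and v' = arc_root[OF assms(2) r]
  have "(u, r) \<notin> joined G (T - {e})"
    using v T_cut[OF arcD(1,2)[OF assms(1)]] joined_sym joined_trans by metis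
  then have "(v, r) \<in> joined G (T - {e} - {e'})"
    using joined_delete'[OF v arcD(2)[OF assms(2)]] by simp
  then have "(v, r) \<in> joined G (T - {e'})"
    using joined_mono[of "T - {e} - {e'}" "T - {e'}" G] by auto
  moreover have "(u, v) \<in> joined G (T - {e'})"
    using arcD(1,2)[OF assms(1)] neq by (intro joined_edge) auto
  ultimately have "(u, v') \<in> joined G (T - {e'})" using v' joined_sym joined_trans by metis
  then show False using T_cut[OF arcD(1,2)[OF assms(2)]] by simp
qed

lemma arc_unique:
  assumes "arc u e v" "arc u e' v'"
  shows "v = v'"
proof -
  have "e = e'" using assms by (rule arc_edge_unique)
  then have "{u, v} = {u, v'}" using arcD(2)[OF assms(1)] arcD(2)[OF assms(2)] by simp
  then show ?thesis by (auto simp: doubleton_eq_iff)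
qed

lemma arc_total:
  assumes "e \<in> T" "ends G e = {u, v}"
  shows "arc u e v \<or> arc v e u"
proof -
  have "u \<in> verts G" using wf_mgraph_ends_subset[OF wf, of e] T_subset assms by auto
  then obtain r where r: "r \<in> R" "(u, r) \<in> joined G T" using ex1_root by blast
  have "u \<noteq> v" using T_no_loop assms by simp
  then show ?thesis
    using joined_delete[OF r(2) assms(2)] assms r(1) unfolding kernel_arc_def by (auto simp: insert_commute)
qed

text \<open>Induction outward from the root. An edge directed from \<open>x\<close> to
  \<open>y\<close> must be the first arc of the route already found for \<open>x\<close>, because
  arcs out of \<open>x\<close> have a unique target; dropping it leaves a route for
  \<open>y\<close>. An edge directed from \<open>y\<close> to \<open>x\<close> is prepended.\<close>

lemma reaches_root:
  assumes "r \<in> R" "(r, v) \<in> joined G T"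
  shows "(v, r) \<in> arcs\<^sup>*"
  using assms(2)
proof (induction rule: joined_induct)
  case (step x y e)
  from arc_total[OF step.hyps(2,3)] show ?case
  proof
    assume xy: "arc x e y"
    then have "x \<noteq> r" using root_no_arc assms(1) by blast
    then obtain x' where x': "(x, x') \<in> arcs" "(x', r) \<in> arcs\<^sup>*"
      using step.IH by (meson converse_rtranclE)
    then have "x' = y" using arc_unique[OF xy] by blast
    with x' show ?thesis by simp
  next
    assume "arc y e x"
    then have "(y, x) \<in> arcs" by blast
    then show ?thesis using step.IH by (rule converse_rtrancl_into_rtrancl)
  qed
qed simp

lemma nonroot_has_arc:
  assumes "v \<in> verts G" "v \<notin> R"
  obtains e u where "arc v e u"
proof -
  obtain r where "r \<in> R" "(v, r) \<in> joined G T" using ex1_root assms(1) by blast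
  then have "(v, r) \<in> arcs\<^sup>*" "v \<noteq> r" using reaches_root joined_sym assms(2) by metis+
  then obtain u where "(v, u) \<in> arcs" by (meson converse_rtranclE)
  then show thesis using that by blast
qed

text \<open>Since outgoing arcs have a unique target, a directed cycle would have to follow the
  route to the root, which no arc leaves. Pairs are (child, parent), so well-founded induction runs
  from the leaves to the root, like the labelling.\<close>

lemma arcs_wf: "Wellfounded.wf arcs"
proof (rule finite_acyclic_wf)
  have "arcs \<subseteq> verts G \<times> verts G"
  proof
    fix p assume "p \<in> arcs"
    then obtain u e v where "p = (u, v)" "arc u e v" by blast
    then show "p \<in> verts G \<times> verts G" using arcD(4,5) by simp
  qed
  then show "finite arcs" using wf_mgraph_finite(1)[OF wf] finite_subset by blast
  show "acyclic arcs"
  proof (rule acyclicI, rule allI, rule notI)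
    fix x assume cyc: "(x, x) \<in> arcs\<^sup>+"
    then obtain y where "(x, y) \<in> arcs" using tranclD by metis
    then have "x \<in> verts G" using arcD(4) by auto
    then obtain r where r: "r \<in> R" "(x, r) \<in> joined G T" using ex1_root by blast
    then have "(x, r) \<in> arcs\<^sup>*" using reaches_root joined_sym by metis
    then have "(x, x) \<notin> arcs\<^sup>+"
    proof (induction rule: converse_rtrancl_induct)
      case base
      show ?case
      proof
        assume "(r, r) \<in> arcs\<^sup>+"
        then obtain y where "(r, y) \<in> arcs" using tranclD by metis
        then show False using root_no_arc[OF r(1)] by auto
      qed
    next
      case (step y z)
      show ?case
      proof
        assume cyc': "(y, y) \<in> arcs\<^sup>+"
        then obtain z' where z': "(y, z') \<in> arcs" "(z', y) \<in> arcs\<^sup>*" using tranclD[OF cyc'] by blast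
        then obtain e e' where "arc y e z'" "arc y e' z" using step.hyps(1) by blast
        then have z'z: "z' = z" by (rule arc_unique)
        have "(z, z) \<in> arcs\<^sup>+"
          using z'(2) step.hyps(1) unfolding z'z by (rule rtrancl_into_trancl1)
        then show False using step.IH by simp
      qed
    qed
    with cyc show False by simp
  qed
qed

abbreviation "children v \<equiv> {u. \<exists>e. arc u e v}"

text \<open>Functional form of the inductive relation: existence comes from \<open>arcs_wf\<close>,
  uniqueness from rule induction. It makes the recursion \<open>label_eq\<close> available as an
  equation.\<close>

definition label :: "'e set \<Rightarrow> 'a set \<Rightarrow> nat" where
  "label A v = (THE l. kernel_label G T R A v l)"

lemma kernel_label_ex: "\<exists>l. kernel_label G T R A v l"
  using arcs_wf
proof (induction v rule: wf_induct_rule)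
  case (less v)
  then have "\<forall>u\<in>children v. \<exists>l. kernel_label G T R A u l" by blast
  then obtain l where "\<forall>u\<in>children v. kernel_label G T R A u (l u)" by metis
  then have "kernel_label G T R A v (card {e \<in> A. v \<in> ends G e} + (\<Sum>u\<in>children v. l u))"
    by (intro kernel_label.intros) blast
  then show ?case by blast
qed

lemma kernel_label_unique:
  "kernel_label G T R A v l \<Longrightarrow> kernel_label G T R A v l' \<Longrightarrow> l = l'"
proof (induction arbitrary: l' rule: kernel_label.induct)
  case (1 v l)
  from \<open>kernel_label G T R A v l'\<close> obtain k where k: "\<And>u. u \<in> children v \<Longrightarrow> kernel_label G T R A u (k u)"
      "l' = card {e \<in> A. v \<in> ends G e} + (\<Sum>u\<in>children v. k u)"
    by (cases rule: kernel_label.cases) blast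
  have "(\<Sum>u\<in>children v. l u) = (\<Sum>u\<in>children v. k u)"
    using "1.IH" k(1) by (intro sum.cong refl) simp
  with k(2) show ?case by simp
qed

lemma kernel_label_iff: "kernel_label G T R A v l \<longleftrightarrow> l = label A v"
proof -
  obtain k where k: "kernel_label G T R A v k" using kernel_label_ex by blast
  then have "label A v = k" unfolding label_def using kernel_label_unique by blast
  with k show ?thesis using kernel_label_unique by blast
qed

lemma label_eq: "label A v = card {e \<in> A. v \<in> ends G e} + (\<Sum>u\<in>children v. label A u)"
proof -
  have "kernel_label G T R A v (card {e \<in> A. v \<in> ends G e} + (\<Sum>u\<in>children v. label A u))"
    by (intro kernel_label.intros) (simp add: kernel_label_iff)
  then show ?thesis by (simp add: kernel_label_iff)
qed

abbreviation "removal A \<equiv> removal_part F G T R A"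

lemma mem_removal: "e \<in> removal A \<longleftrightarrow> (\<exists>u v. arc u e v \<and> u \<subseteq> F \<and> odd (label A u))"
  unfolding removal_part_def kernel_label_iff using arcD(1) by blast

lemma removal_subset: "removal A \<subseteq> T"
  by (auto simp: removal_part_def)

lemma finite_children: "finite (children v)"
proof -
  have "children v \<subseteq> verts G" using arcD(4) by blast
  then show ?thesis using wf_mgraph_finite(1)[OF wf] by (rule finite_subset)
qed

text \<open>The removal edges at \<open>v\<close> are the arcs from the children with odd label and,
  exactly if the label of \<open>v\<close> is odd, the arc out of \<open>v\<close>. As that label is
  the degree in \<open>A\<close> plus the labels of the children, the total is even.\<close>

lemma even_degree_nonroot:
  assumes "v \<in> verts G" "v \<notin> R" "v \<subseteq> F" "finite A" "A \<inter> T = {}"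
  shows "even (card {e \<in> A \<union> removal A. v \<in> ends G e})"
proof -
  obtain e0 p where e0: "arc v e0 p" using nonroot_has_arc assms(1,2) by blast
  define out where "out = (\<lambda>u. THE e. arc u e v)"
  have out_eq: "out u = e" if "arc u e v" for u e
    unfolding out_def using that by (rule the_equality) (rule arc_edge_unique[OF _ that])
  then have out: "arc u (out u) v" if "u \<in> children v" for u
    using that by auto
  define D where "D = {u \<in> children v. odd (label A u)}"
  have "inj_on out D"
  proof (rule inj_onI)
    fix u u' assume u: "u \<in> D" and u': "u' \<in> D" and eq: "out u = out u'"
    have a: "arc u (out u) v" and a': "arc u' (out u) v"
      using out[of u] out[of u'] u u' eq unfolding D_def by simp_all
    have "{u, v} = {u', v}" using arcD(2)[OF a] arcD(2)[OF a'] by simp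
    then show "u = u'" using arcD(3)[OF a] arcD(3)[OF a'] by (auto simp: doubleton_eq_iff)
  qed
  then have card_out: "card (out ` D) = card D" by (rule card_image)
  have fin: "finite D" unfolding D_def using finite_children by simp
  have e0_out: "e0 \<notin> out ` D"
  proof
    assume "e0 \<in> out ` D"
    then obtain u where "arc u e0 v" using out unfolding D_def by auto
    then have "arc p e0 v" using arcD(2,3)[OF e0] arcD(2)[of u e0 v] by (auto simp: doubleton_eq_iff)
    then show False using arc_asym[OF e0] by simp
  qed
  have "e \<in> removal A \<and> v \<in> ends G e \<longleftrightarrow> e \<in> out ` D \<or> odd (label A v) \<and> e = e0" for e
  proof
    assume e: "e \<in> removal A \<and> v \<in> ends G e"
    then obtain u q where uq: "arc u e q" "odd (label A u)" using mem_removal by blast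
    then have "v = u \<or> v = q" using e arcD(2)[OF uq(1)] by simp
    then show "e \<in> out ` D \<or> odd (label A v) \<and> e = e0"
    proof
      assume "v = u"
      then show ?thesis using uq arc_edge_unique[OF e0] by blast
    next
      assume "v = q"
      then have "u \<in> D" "e = out u" using uq out_eq unfolding D_def by auto
      then show ?thesis by blast
    qed
  next
    assume "e \<in> out ` D \<or> odd (label A v) \<and> e = e0"
    then show "e \<in> removal A \<and> v \<in> ends G e"
    proof
      assume "e \<in> out ` D"
      then obtain u where u: "arc u e v" "odd (label A u)" using out unfolding D_def by auto
      have "u \<subseteq> F" using joined_same_label[OF arcD(6)[OF u(1)]] assms(3) by simp
      then show ?thesis using u arcD(2)[OF u(1)] mem_removal by auto
    next
      assume "odd (label A v) \<and> e = e0"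
      then show ?thesis using e0 arcD(2)[OF e0] assms(3) mem_removal by auto
    qed
  qed
  then have "{e \<in> removal A. v \<in> ends G e} = out ` D \<union> (if odd (label A v) then {e0} else {})"
    by auto
  then have "odd (card {e \<in> removal A. v \<in> ends G e}) \<longleftrightarrow> odd (card D) \<noteq> odd (label A v)"
    using card_out e0_out fin by auto
  moreover have "odd (label A v) \<longleftrightarrow> odd (card {e \<in> A. v \<in> ends G e}) \<noteq> odd (card D)"
    unfolding D_def label_eq[of A v] using even_sum_iff[OF finite_children[of v], of "label A"]
    by (simp add: mem_Collect_eq)
  moreover have "card {e \<in> A \<union> removal A. v \<in> ends G e} =
     card {e \<in> A. v \<in> ends G e} + card {e \<in> removal A. v \<in> ends G e}"
  proof -
    have "finite (removal A)" using removal_subset finite_T finite_subset by metis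
    moreover have "{e \<in> A \<union> removal A. v \<in> ends G e} =
       {e \<in> A. v \<in> ends G e} \<union> {e \<in> removal A. v \<in> ends G e}" by blast
    moreover have "{e \<in> A. v \<in> ends G e} \<inter> {e \<in> removal A. v \<in> ends G e} = {}"
      using removal_subset[of A] assms(5) by blast
    ultimately show ?thesis using assms(4) by (simp add: card_Un_disjoint)
  qed
  ultimately show ?thesis by auto
qed

text \<open>
  At a root the parity is not controlled by a label; it follows from the other vertices of the
  kernel, because the removal edges of the kernel do not cross its boundary.
\<close>

lemma even_degree:
  assumes "v \<in> verts G" "v \<subseteq> F" "A \<subseteq> edges G - T"
    and no_loop: "\<And>e V. e \<in> A \<Longrightarrow> ends (contract T G) e \<noteq> {V}"
    and even: "\<And>V. V \<in> verts (contract T G) \<Longrightarrow> V \<subseteq> F \<Longrightarrow>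
      even (card {e \<in> A. V \<in> ends (contract T G) e})"
  shows "even (card {e \<in> A \<union> removal A. v \<in> ends G e})"
proof (cases "v \<in> R")
  case False
  have "finite A" using assms(3) wf_mgraph_finite(2)[OF wf] finite_subset by blast
  moreover have "A \<inter> T = {}" using assms(3) by blast
  ultimately show ?thesis using even_degree_nonroot assms(1,2) False by blast
next
  case True
  define D where "D = {u \<in> verts G. (u, v) \<in> joined G T}"
  define B where "B = A \<union> removal A"
  have finA: "finite A" using assms(3) wf_mgraph_finite(2)[OF wf] finite_subset by blast
  then have finB: "finite B" unfolding B_def using removal_subset finite_T finite_subset by blast
  have finD: "finite D" unfolding D_def using wf_mgraph_finite(1)[OF wf] by simp
  have AT: "A \<inter> T = {}" using assms(3) by blast
  have D: "u \<subseteq> F \<and> (u \<notin> R \<or> u = v)" if "u \<in> D" for u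
  proof -
    have u: "u \<in> verts G" "(u, v) \<in> joined G T" using that by (simp_all add: D_def)
    have "u = v" if "u \<in> R" using ex1_root[OF u(1)] that True u(2) joined_refl[of u] by blast
    then show ?thesis using joined_same_label[OF u(2)] assms(2) by blast
  qed
  have nonroot: "u \<notin> mod2_sum (ends G) B" if "u \<in> D - {v}" for u
  proof -
    have "even (card {e \<in> B. u \<in> ends G e})"
      unfolding B_def using that D[of u] finA AT by (intro even_degree_nonroot) (auto simp: D_def)
    then show ?thesis by (simp add: mem_mod2_sum)
  qed
  let ?V = "merged G T v"
  \<comment> \<open>\<open>D\<close> is the vertex set of the kernel of \<open>v\<close>. Removal
    edges have both or no ends in it. An edge of \<open>A\<close> leaves it exactly if it ends at
    \<open>?V\<close> after contraction, as \<open>no_loop\<close> forbids both ends in one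
    kernel.\<close>
  have crossing: "odd (card (D \<inter> ends G e)) \<longleftrightarrow> e \<in> A \<and> ?V \<in> ends (contract T G) e" if "e \<in> B" for e
  proof (cases "e \<in> A")
    case eA: True
    then have "e \<in> edges G" using assms(3) by blast
    from wf this obtain a b where ab: "a \<in> verts G" "b \<in> verts G" "ends G e = {a, b}"
      by (rule wf_mgraph_endsE)
    then have "merged G T a \<noteq> merged G T b" using no_loop[OF eA, of "merged G T a"] by auto
    then have "a \<noteq> b" by blast
    moreover have "u \<in> D \<longleftrightarrow> merged G T u = ?V" if "u \<in> verts G" for u
      unfolding D_def using merged_eq_iff[OF wf T_subset that assms(1)] that by simp
    moreover have "?V \<in> ends (contract T G) e \<longleftrightarrow> merged G T a = ?V \<or> merged G T b = ?V"
      using ab(3) by auto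
    ultimately show ?thesis
      using eA ab \<open>merged G T a \<noteq> merged G T b\<close> odd_card_Int_pair[of a b D] by metis
  next
    case eA: False
    then have "e \<in> removal A" using that B_def by blast
    then obtain a b where ab: "arc a e b" using mem_removal by blast
    have "(a, v) \<in> joined G T \<longleftrightarrow> (b, v) \<in> joined G T"
      using arcD(6)[OF ab] joined_sym joined_trans by metis
    then have "a \<in> D \<longleftrightarrow> b \<in> D" unfolding D_def using arcD(4,5)[OF ab] by simp
    then show ?thesis using eA arcD(2,3)[OF ab] by (simp add: odd_card_Int_pair)
  qed
  have "odd (card (D \<inter> mod2_sum (ends G) B)) \<longleftrightarrow> odd (card {e \<in> B. odd (card (D \<inter> ends G e))})"
    by (rule odd_card_Int_mod2_sum[OF finD finB])
  also have "{e \<in> B. odd (card (D \<inter> ends G e))} = {e \<in> A. ?V \<in> ends (contract T G) e}"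
    using crossing unfolding B_def by blast
  finally have "odd (card (D \<inter> mod2_sum (ends G) B)) \<longleftrightarrow>
    odd (card {e \<in> A. ?V \<in> ends (contract T G) e})" .
  moreover have "even (card {e \<in> A. ?V \<in> ends (contract T G) e})"
  proof (rule even)
    show "?V \<in> verts (contract T G)" using assms(1) by simp
    show "?V \<subseteq> F"
      using joined_same_label assms(2) unfolding merged_def by blast
  qed
  ultimately have "even (card (D \<inter> mod2_sum (ends G) B))" by simp
  \<comment> \<open>The other vertices of the kernel are even already, so an odd \<open>v\<close>
    would be the only odd one and the number of crossing edges would be odd.\<close>
  moreover have "D \<inter> mod2_sum (ends G) B = {v}" if "v \<in> mod2_sum (ends G) B"
    using that nonroot assms(1) unfolding D_def by auto
  ultimately have "v \<notin> mod2_sum (ends G) B" by auto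
  then show ?thesis by (simp add: mem_mod2_sum B_def)
qed

end

section \<open>Pyramids\<close>

lemma wf_mgraph_base_graph: "wf_mgraph (base_graph w h)"
proof -
  have "\<exists>u\<in>verts (base_graph w h). \<exists>v\<in>verts (base_graph w h). ends (base_graph w h) e = {u, v}"
    if "e \<in> base_edges w h" for e
    by (rule base_edgesE[OF that]) (auto simp: base_graph_def)
  then show ?thesis unfolding wf_mgraph_def by (auto simp: base_graph_def)
qed

lemma dual_vertex_inner: "c \<in> {0<..<w} \<times> {0<..<h} \<Longrightarrow> dual_vertex w h c = {c}"
  by (simp add: dual_vertex_def)

lemma dual_vertex_mem: "c \<in> {..w} \<times> {..h} \<Longrightarrow> c \<in> dual_vertex w h c"
  by (simp add: dual_vertex_def)

lemma dual_vertex_overlap: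
  assumes "x \<in> dual_vertex w h c" "x \<in> dual_vertex w h d"
  shows "dual_vertex w h c = dual_vertex w h d"
  using assms unfolding dual_vertex_def by (auto split: if_splits)

lemma sides_cases:
  assumes "e \<in> base_edges w h"
  obtains c d where "sides e = {c, d}" "c \<noteq> d" "c \<in> {..w} \<times> {..h}" "d \<in> {..w} \<times> {..h}"
proof -
  from assms consider i j where "Suc i < w" "j < h" "e = {(i, j), (Suc i, j)}"
    | i j where "i < w" "Suc j < h" "e = {(i, j), (i, Suc j)}"
    unfolding base_edges_iff by blast
  then show thesis
  proof cases
    case 1
    show thesis
      by (rule that[of "(Suc i, j)" "(Suc i, Suc j)"]) (use 1 sides_horizontal in auto)
  next
    case 2
    show thesis
      by (rule that[of "(i, Suc j)" "(Suc i, Suc j)"]) (use 2 sides_vertical in auto)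
  qed
qed

lemma wf_mgraph_base_dual: "wf_mgraph (base_dual w h)"
  unfolding wf_mgraph_def
proof (intro conjI ballI impI)
  show "finite (verts (base_dual w h))" "finite (edges (base_dual w h))"
    by (simp_all add: base_dual_def)
  show "{} \<notin> verts (base_dual w h)" using dual_vertex_mem by (fastforce simp: base_dual_def)
  fix u v assume "u \<in> verts (base_dual w h)" "v \<in> verts (base_dual w h)" "u \<inter> v \<noteq> {}"
  then obtain x c d where "u = dual_vertex w h c" "v = dual_vertex w h d" "x \<in> u" "x \<in> v"
    by (simp add: base_dual_def) blast
  then show "u = v" using dual_vertex_overlap by metis
next
  fix e assume "e \<in> edges (base_dual w h)"
  then have "e \<in> base_edges w h" by (simp add: base_dual_def)
  then show "\<exists>u\<in>verts (base_dual w h). \<exists>v\<in>verts (base_dual w h). ends (base_dual w h) e = {u, v}"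
    by (rule sides_cases) (simp add: base_dual_def, blast)
qed

locale pyramid =
  fixes w h n :: nat and F :: "point set"
    and G Gd :: "nat \<Rightarrow> (point, edge) mgraph"
    and T S :: "nat \<Rightarrow> edge set" and R :: "nat \<Rightarrow> point set set"
  assumes image: "binary_image w h F"
    and pyramid: "graph_pyramid w h F n G Gd T R S"
begin

definition P :: "nat \<Rightarrow> edge set" where
  "P k = pendant_edges (remove (T k) (Gd k))"

lemma G_0: "G 0 = base_graph w h" and Gd_0: "Gd 0 = base_dual w h"
  using pyramid by (simp_all add: graph_pyramid_def)

lemma level_step:
  assumes "k < n"
  shows "contraction_kernels F (G k) (T k) (R k)"
    and "forest (contract (P k) (remove (T k) (Gd k))) (S k)"
    and "G (Suc k) = remove (S k) (remove (P k) (contract (T k) (G k)))"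
    and "Gd (Suc k) = contract (S k) (contract (P k) (remove (T k) (Gd k)))"
  using pyramid assms by (simp_all add: graph_pyramid_def Let_def P_def degree2_choice_def)

lemma T_subset: "k < n \<Longrightarrow> T k \<subseteq> edges (G k)"
  using level_step(1) by (auto simp: contraction_kernels_def forest_def)

lemma wf_levels: "k \<le> n \<Longrightarrow> wf_mgraph (G k) \<and> wf_mgraph (Gd k) \<and> edges (Gd k) = edges (G k)"
proof (induction k)
  case 0
  show ?case using wf_mgraph_base_graph wf_mgraph_base_dual
    by (simp add: G_0 Gd_0) (simp add: base_graph_def base_dual_def)
next
  case (Suc k)
  then have k: "k < n" and IH: "wf_mgraph (G k)" "wf_mgraph (Gd k)" "edges (Gd k) = edges (G k)" by auto
  have P: "P k \<subseteq> edges (remove (T k) (Gd k))" unfolding P_def by (rule pendant_edges_subset)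
  have S: "S k \<subseteq> edges (contract (P k) (remove (T k) (Gd k)))"
    using level_step(2)[OF k] by (simp add: forest_def)
  have "wf_mgraph (Gd (Suc k))"
    unfolding level_step(4)[OF k] by (intro wf_mgraph_contract wf_mgraph_remove IH P S)
  moreover have "wf_mgraph (G (Suc k))"
    unfolding level_step(3)[OF k] by (intro wf_mgraph_contract wf_mgraph_remove IH T_subset k)
  moreover have "edges (Gd (Suc k)) = edges (G (Suc k))"
    using IH(3) by (simp add: level_step(3,4)[OF k])
  ultimately show ?case by blast
qed

lemma wf_G: "k \<le> n \<Longrightarrow> wf_mgraph (G k)" and wf_Gd: "k \<le> n \<Longrightarrow> wf_mgraph (Gd k)"
  and edges_Gd: "k \<le> n \<Longrightarrow> edges (Gd k) = edges (G k)"
  using wf_levels by auto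

lemma edges_Suc: "k < n \<Longrightarrow> edges (G (Suc k)) = edges (G k) - T k - P k - S k"
  by (simp add: level_step(3))

lemma P_subset: "k < n \<Longrightarrow> P k \<subseteq> edges (G k) - T k"
  using pendant_edges_subset[of "remove (T k) (Gd k)"] edges_Gd[of k] by (simp add: P_def)

lemma S_subset: "k < n \<Longrightarrow> S k \<subseteq> edges (G k) - T k - P k"
  using level_step(2)[of k] edges_Gd[of k] by (simp add: forest_def)

lemma edges_antimono: "i \<le> j \<Longrightarrow> j \<le> n \<Longrightarrow> edges (G j) \<subseteq> edges (G i)"
proof (induction j rule: dec_induct)
  case (step j)
  then show ?case using edges_Suc[of j] by auto
qed simp

lemma edges_cover: "k \<le> n \<Longrightarrow> edges (G 0) = edges (G k) \<union> (\<Union>j<k. T j \<union> P j \<union> S j)"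
proof (induction k)
  case (Suc k)
  then have k: "k < n" by simp
  have "edges (G k) = edges (G (Suc k)) \<union> (T k \<union> P k \<union> S k)"
    using edges_Suc[OF k] T_subset[OF k] P_subset[OF k] S_subset[OF k] by auto
  then show ?case using Suc by (simp add: lessThan_Suc Un_ac)
qed simp

text \<open>An edge is a set of two pixels and a vertex is its receptive field, so incidence at
  every level is read off from the pixels without following the merges.\<close>

lemma ends_level:
  "k \<le> n \<Longrightarrow> e \<in> edges (G k) \<Longrightarrow> ends (G k) e = {v \<in> verts (G k). v \<inter> e \<noteq> {}}"
proof (induction k)
  case 0
  then have "e \<subseteq> pixels w h" by (auto simp: G_0 base_graph_def dest: base_edges_subset_pixels)
  then show ?case by (auto simp: G_0 base_graph_def)
next
  case (Suc k)
  then have k: "k < n" by simp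
  have e: "e \<in> edges (G k)" using Suc.prems edges_Suc[OF k] by simp
  have IH: "ends (G k) e = {v \<in> verts (G k). v \<inter> e \<noteq> {}}" using Suc.IH k e by simp
  let ?M = "merged (G k) (T k)"
  have "?M v \<inter> e \<noteq> {} \<longleftrightarrow> ?M v \<in> ?M ` ends (G k) e" if v: "v \<in> verts (G k)" for v
  proof
    assume "?M v \<inter> e \<noteq> {}"
    then obtain x u where u: "(v, u) \<in> joined (G k) (T k)" "x \<in> u" "x \<in> e"
      by (auto simp: mem_merged)
    have "u \<in> verts (G k)"
      using joined_verts[OF wf_G T_subset v u(1)] k by simp
    then have "u \<in> ends (G k) e" using IH u by blast
    then show "?M v \<in> ?M ` ends (G k) e" using joined_imp_merged_eq[OF u(1)] by simp
  next
    assume "?M v \<in> ?M ` ends (G k) e"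
    then obtain u where u: "u \<in> verts (G k)" "u \<inter> e \<noteq> {}" "?M v = ?M u" using IH by auto
    have "x \<in> ?M u" if "x \<in> u" for x using that joined_refl unfolding mem_merged by blast
    then show "?M v \<inter> e \<noteq> {}" using u by auto
  qed
  moreover have "ends (G k) e \<subseteq> verts (G k)" using IH by blast
  ultimately show ?case by (auto simp: level_step(3)[OF k])
qed

text \<open>The third claim says that a receptive field is connected through the edges contracted so
  far. It later turns a loop or a pair of parallel edges at the top into a cycle of the pixel
  grid.\<close>

lemma verts_level:
  assumes "k \<le> n" "V \<in> verts (G k)"
  shows "V \<subseteq> pixels w h" "V \<subseteq> F \<or> V \<inter> F = {}"
    and "p \<in> V \<Longrightarrow> q \<in> V \<Longrightarrow> (p, q) \<in> {(a, b). a \<noteq> b \<and> {a, b} \<in> (\<Union>j<k. T j)}\<^sup>*"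
proof -
  have "V \<subseteq> pixels w h \<and> (V \<subseteq> F \<or> V \<inter> F = {}) \<and>
    (\<forall>p\<in>V. \<forall>q\<in>V. (p, q) \<in> {(a, b). a \<noteq> b \<and> {a, b} \<in> (\<Union>j<k. T j)}\<^sup>*)"
    using assms
  proof (induction k arbitrary: V)
    case 0
    then show ?case by (auto simp: G_0 base_graph_def)
  next
    case (Suc k)
    let ?r = "\<lambda>k. {(a, b). a \<noteq> b \<and> {a, b} \<in> (\<Union>j<k. T j)}"
    have k: "k < n" "k \<le> n" using Suc.prems by auto
    interpret kernels F "G k" "T k" "R k"
      using wf_G level_step(1) k by unfold_locales auto
    have IH: "v \<subseteq> pixels w h" "v \<subseteq> F \<or> v \<inter> F = {}"
        "p \<in> v \<Longrightarrow> q \<in> v \<Longrightarrow> (p, q) \<in> (?r (Suc k))\<^sup>*" if v: "v \<in> verts (G k)" for v p q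
    proof -
      show "v \<subseteq> pixels w h" "v \<subseteq> F \<or> v \<inter> F = {}" using Suc.IH[OF k(2) v] by auto
      assume "p \<in> v" "q \<in> v"
      then have "(p, q) \<in> (?r k)\<^sup>*" using Suc.IH[OF k(2) v] by auto
      moreover have "?r k \<subseteq> ?r (Suc k)" by auto
      ultimately show "(p, q) \<in> (?r (Suc k))\<^sup>*" using rtrancl_mono by blast
    qed
    obtain v where v: "v \<in> verts (G k)" and V: "V = merged (G k) (T k) v"
      using Suc.prems by (auto simp: level_step(3)[OF k(1)])
    have u_verts: "u \<in> verts (G k)" if "(v, u) \<in> joined (G k) (T k)" for u
      using joined_verts[OF wf_G T_subset v that] k by simp
    have path: "(p, q) \<in> (?r (Suc k))\<^sup>*"
      if "(u, u') \<in> joined (G k) (T k)" "u \<in> verts (G k)" "p \<in> u" "q \<in> u'" for u u' p q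
      using that
    proof (induction arbitrary: q rule: joined_induct)
      case refl
      then show ?case using IH(3) by blast
    next
      case (step x y e)
      have e: "e \<in> edges (G k)" using step.hyps T_subset by blast
      have x: "x \<in> verts (G k)" "y \<in> verts (G k)" "x \<inter> e \<noteq> {}" "y \<inter> e \<noteq> {}"
        using ends_level[OF k(2) e] step.hyps(3) by blast+
      then obtain a b where ab: "a \<in> x" "a \<in> e" "b \<in> y" "b \<in> e" by blast
      have "e \<in> base_edges w h"
        using e edges_antimono[of 0 k] k by (auto simp: G_0 base_graph_def)
      then have "a \<noteq> b \<Longrightarrow> e = {a, b}" using ab by (elim base_edgesE) auto
      then have "(a, b) \<in> (?r (Suc k))\<^sup>*" using step.hyps(2) by (cases "a = b") auto
      moreover have "(p, a) \<in> (?r (Suc k))\<^sup>*" using step.IH step.prems ab by blast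
      moreover have "(b, q) \<in> (?r (Suc k))\<^sup>*" using IH(3)[OF x(2) ab(3)] step.prems by blast
      ultimately show ?case by (meson rtrancl_trans)
    qed
    have "V \<subseteq> pixels w h" using u_verts IH(1) unfolding V merged_def by blast
    moreover have "V \<subseteq> F \<or> V \<inter> F = {}"
    proof (cases "v \<subseteq> F")
      case True
      then have "V \<subseteq> F" using joined_same_label unfolding V merged_def by blast
      then show ?thesis by simp
    next
      case False
      then have "u \<inter> F = {}" if "(v, u) \<in> joined (G k) (T k)" for u
        using joined_same_label[OF that] IH(2)[OF u_verts[OF that]] by simp
      then have "V \<inter> F = {}" unfolding V merged_def by blast
      then show ?thesis by simp
    qed
    moreover have "(p, q) \<in> (?r (Suc k))\<^sup>*" if pq: "p \<in> V" "q \<in> V" for p q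
    proof -
      obtain u u' where u: "(v, u) \<in> joined (G k) (T k)" "p \<in> u" "(v, u') \<in> joined (G k) (T k)" "q \<in> u'"
        using pq unfolding V mem_merged by blast
      then have "(u, u') \<in> joined (G k) (T k)" using joined_sym joined_trans by metis
      then show ?thesis using path u u_verts by blast
    qed
    ultimately show ?case by blast
  qed
  then show "V \<subseteq> pixels w h" "V \<subseteq> F \<or> V \<inter> F = {}"
    "p \<in> V \<Longrightarrow> q \<in> V \<Longrightarrow> (p, q) \<in> {(a, b). a \<noteq> b \<and> {a, b} \<in> (\<Union>j<k. T j)}\<^sup>*" by auto
qed

text \<open>The edges contracted from level \<open>k\<close> upward, so that tree properties can be
  carried down from \<open>Z\<close> at level \<open>n\<close> to level 0, where all contracted
  edges are collected.\<close>

definition dual_contracted :: "edge set \<Rightarrow> nat \<Rightarrow> edge set" where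
  "dual_contracted Z k = (\<Union>j\<in>{k..<n}. P j \<union> S j) \<union> Z"

lemma dual_contracted_n [simp]: "dual_contracted Z n = Z"
  by (simp add: dual_contracted_def)

lemma dual_contracted_Suc:
  assumes "k < n"
  shows "dual_contracted Z k = P k \<union> (S k \<union> dual_contracted Z (Suc k))"
proof -
  have "{k..<n} = insert k {Suc k..<n}" using assms by auto
  then show ?thesis by (simp add: dual_contracted_def Un_assoc)
qed

lemma contracted_edges_eq: "contracted_edges n Gd T S Z = dual_contracted Z 0"
  by (simp add: contracted_edges_def dual_contracted_def P_def atLeast0LessThan)

lemma dual_contracted_subset:
  assumes "Z \<subseteq> edges (G n)" "k \<le> n"
  shows "dual_contracted Z k \<subseteq> edges (G k)"
  using assms(2)
proof (induction k rule: inc_induct)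
  case (step k)
  then show ?case
    using P_subset[of k] S_subset[of k] edges_Suc[of k] by (auto simp: dual_contracted_Suc)
qed (use assms(1) in simp)

text \<open>Descending from the spanning tree \<open>Z\<close>, undoing the contractions of
  \<open>S k\<close> and then of \<open>P k\<close> costs exactly these edges, while putting
  \<open>T k\<close> back changes no vertex.\<close>

lemma dual_connected:
  assumes "spanning_tree (Gd n) Z" "k \<le> n"
  shows "connected_by (Gd k) (dual_contracted Z k)"
  using assms(2)
proof (induction k rule: inc_induct)
  case base
  then show ?case using assms(1) by (simp add: spanning_tree_def connected_by_def)
next
  case (step k)
  then have k: "k < n" "Suc k \<le> n" by auto
  have Z: "Z \<subseteq> edges (G n)" using assms(1) edges_Gd[of n] by (simp add: spanning_tree_def forest_def)
  let ?H = "remove (T k) (Gd k)"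
  have H: "wf_mgraph ?H" "edges ?H = edges (G k) - T k"
    using wf_Gd edges_Gd k by (simp_all add: wf_mgraph_remove)
  have P: "P k \<subseteq> edges ?H" using P_subset[OF k(1)] H(2) by simp
  have S: "S k \<subseteq> edges (contract (P k) ?H)" using S_subset[OF k(1)] H(2) by auto
  have C: "dual_contracted Z (Suc k) \<subseteq> edges (G k) - T k - P k - S k"
    using dual_contracted_subset[OF Z k(2)] edges_Suc[OF k(1)] by simp
  have "connected_by (contract (P k) ?H) (S k \<union> dual_contracted Z (Suc k))"
    by (rule connected_by_contract[OF wf_mgraph_contract[OF H(1) P] S])
      (use step.IH C H(2) in \<open>auto simp: level_step(4)[OF k(1)]\<close>)
  then have "connected_by ?H (P k \<union> (S k \<union> dual_contracted Z (Suc k)))"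
    by (intro connected_by_contract[OF H(1) P]) (use S C H(2) in auto)
  then show ?case by (simp add: dual_contracted_Suc k)
qed

text \<open>Even cuts pass to level k + 1, where the rest of \<open>z\<close> vanishes by induction.
  What remains lies first in \<open>S k\<close> and \<open>P k\<close>; its image after contracting
  \<open>P k\<close> lies in the forest \<open>S k\<close> and vanishes, and then only bridges in
  \<open>P k\<close> are left.\<close>

lemma dual_acyclic:
  assumes "spanning_tree (Gd n) Z" "k \<le> n"
  shows "z \<subseteq> dual_contracted Z k \<Longrightarrow> even_cuts (Gd k) z \<Longrightarrow> z = {}"
  using assms(2)
proof (induction k arbitrary: z rule: inc_induct)
  case base
  have "forest (Gd n) Z" using assms(1) by (simp add: spanning_tree_def)
  then show ?case
    using forest_no_even_cuts[OF wf_Gd[OF order_refl]] base by simp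
next
  case (step k)
  then have k: "k < n" "Suc k \<le> n" "k \<le> n" by auto
  have Z: "Z \<subseteq> edges (G n)" using assms(1) edges_Gd[of n] by (simp add: spanning_tree_def forest_def)
  let ?H = "remove (T k) (Gd k)"
  have H: "wf_mgraph ?H" "edges ?H = edges (G k) - T k"
    using wf_Gd edges_Gd k by (simp_all add: wf_mgraph_remove)
  have P: "P k \<subseteq> edges ?H" using P_subset[OF k(1)] H(2) by simp
  note H' = wf_mgraph_contract[OF H(1) P]
  have S: "S k \<subseteq> edges (contract (P k) ?H)" using S_subset[OF k(1)] H(2) by auto
  have C: "dual_contracted Z (Suc k) \<subseteq> edges (G k) - T k - P k - S k"
    using dual_contracted_subset[OF Z k(2)] edges_Suc[OF k(1)] by simp
  have z: "z \<subseteq> P k \<union> (S k \<union> dual_contracted Z (Suc k))"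
    using step.prems(1) by (simp add: dual_contracted_Suc k)
  have zH: "z \<subseteq> edges ?H" using z P S C H(2) by auto
  have even1: "even_cuts (contract (P k) ?H) (z - P k)"
    using even_cuts_contract[OF H(1) P zH] step.prems(2) by simp
  have zH1: "z - P k \<subseteq> edges (contract (P k) ?H)" using zH by auto
  have "even_cuts (Gd (Suc k)) (z - P k - S k)"
    using even_cuts_contract[OF H' S zH1 even1] by (simp add: level_step(4)[OF k(1)])
  then have "z - P k - S k = {}" using z by (intro step.IH) auto
  then have "z - P k = {}"
    using forest_no_even_cuts[OF H' level_step(2)[OF k(1)] _ even1] by blast
  then have "z \<subseteq> pendant_edges ?H" unfolding P_def by blast
  then show ?case using pendant_no_even_cuts[OF H(1)] step.prems(2) by simp
qed

lemma T_disjoint: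
  assumes "Z \<subseteq> edges (G n)" "k < n"
  shows "T k \<inter> dual_contracted Z 0 = {}" "T k \<inter> edges (G n) = {}"
proof -
  have "T k \<inter> (P j \<union> S j) = {}" if "j < n" for j
  proof (cases "k \<le> j")
    case True
    have "edges (G j) - T j \<subseteq> - T k"
      using True edges_antimono[of "Suc k" j] edges_Suc[OF assms(2)] that by (cases "k = j") auto
    then show ?thesis using P_subset[OF that] S_subset[OF that] by blast
  next
    case False
    then have "T k \<subseteq> edges (G (Suc j))"
      using edges_antimono[of "Suc j" k] T_subset[OF assms(2)] assms(2) by auto
    then show ?thesis using edges_Suc[OF that] by blast
  qed
  moreover show "T k \<inter> edges (G n) = {}"
    using edges_antimono[of "Suc k" n] edges_Suc[OF assms(2)] assms(2) by auto
  ultimately show "T k \<inter> dual_contracted Z 0 = {}"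
    using assms(1) unfolding dual_contracted_def by fastforce
qed

lemma edges_n_disjoint: "(edges (G n) - Z) \<inter> dual_contracted Z 0 = {}"
proof -
  have "edges (G n) \<inter> (P j \<union> S j) = {}" if "j < n" for j
    using edges_antimono[of "Suc j" n] edges_Suc[OF that] that by auto
  then show ?thesis unfolding dual_contracted_def by fastforce
qed

lemma base_edges_cover:
  "base_edges w h = (\<Union>k<n. T k) \<union> dual_contracted Z 0 \<union> (edges (G n) - Z)" if "Z \<subseteq> edges (G n)"
proof -
  have "base_edges w h = edges (G 0)" by (simp add: G_0 base_graph_def)
  also have "\<dots> = edges (G n) \<union> (\<Union>k<n. T k \<union> P k \<union> S k)" by (rule edges_cover) simp
  also have "\<dots> = (\<Union>k<n. T k) \<union> dual_contracted Z 0 \<union> (edges (G n) - Z)"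
    using that by (auto simp: dual_contracted_def)
  finally show ?thesis .
qed

lemma verts_cover:
  "k \<le> n \<Longrightarrow> p \<in> pixels w h \<Longrightarrow> \<exists>v\<in>verts (G k). p \<in> v"
proof (induction k)
  case 0
  then show ?case by (auto simp: G_0 base_graph_def)
next
  case (Suc k)
  then obtain v where v: "v \<in> verts (G k)" "p \<in> v" by auto
  then have "p \<in> merged (G k) (T k) v" using joined_refl unfolding mem_merged by blast
  then show ?case using v Suc.prems by (auto simp: level_step(3))
qed

lemma T_same_label:
  assumes "k < n" "e \<in> T k" "p \<in> e" "q \<in> e"
  shows "p \<in> F \<longleftrightarrow> q \<in> F"
proof -
  have k: "k \<le> n" using assms(1) by simp
  have e: "e \<in> edges (G k)" using assms T_subset by blast
  then have "e \<in> base_edges w h" using edges_antimono[of 0 k] k by (auto simp: G_0 base_graph_def)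
  then have "p \<in> pixels w h" "q \<in> pixels w h" using base_edges_subset_pixels assms by blast+
  then obtain u v where u: "u \<in> verts (G k)" "p \<in> u" and v: "v \<in> verts (G k)" "q \<in> v"
    using verts_cover k by meson
  then have "u \<in> ends (G k) e" "v \<in> ends (G k) e" using ends_level[OF k e] assms(3,4) by blast+
  then have "u \<subseteq> F \<longleftrightarrow> v \<subseteq> F"
    using level_step(1)[OF assms(1)] assms(2) unfolding contraction_kernels_def by blast
  then show ?thesis using verts_level(2)[OF k u(1)] verts_level(2)[OF k v(1)] u v by blast
qed

end

section \<open>Homology generators\<close>

context pyramid begin

abbreviation "object_edges \<equiv> {e \<in> base_edges w h. e \<inter> F \<noteq> {}}"

lemma F_pixels: "F \<subseteq> pixels w h"
  using image by (simp add: binary_image_def)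

text \<open>Object pixels stay off the image border, so the collapsed rim vertex never belongs to
  the complex and boundaries in it can be computed with plain grid points.\<close>

lemma sides_object_edge:
  assumes "e \<in> object_edges"
  shows "sides e \<subseteq> {0<..<w} \<times> {0<..<h}"
proof -
  obtain i j where ij: "(i, j) \<in> e" "(i, j) \<in> F" using assms by auto
  then have "0 < i \<and> Suc i < w \<and> 0 < j \<and> Suc j < h"
    using image unfolding binary_image_def by blast
  then have "corners (i, j) \<subseteq> {0<..<w} \<times> {0<..<h}" by (auto simp: corners_def)
  then show ?thesis using ij by blast
qed

definition "K = boundary_complex F (G 0) (Gd 0)"

lemma K_simps:
  "cfaces K = (\<lambda>p. {p}) ` F" "cedges K = object_edges"
  "cverts K = \<Union> (ends (Gd 0) ` object_edges)"
  "bd1 K e = (if \<exists>v. ends (Gd 0) e = {v} then {} else ends (Gd 0) e)"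
proof -
  have Fs: "{v \<in> verts (G 0). v \<subseteq> F} = (\<lambda>p. {p}) ` F"
    using F_pixels by (auto simp: G_0 base_graph_def)
  have Es: "{e \<in> edges (G 0). ends (G 0) e \<inter> (\<lambda>p. {p}) ` F \<noteq> {}} = object_edges"
    by (auto simp: G_0 base_graph_def)
  show "cfaces K = (\<lambda>p. {p}) ` F" "cedges K = object_edges"
    "cverts K = \<Union> (ends (Gd 0) ` object_edges)"
    "bd1 K e = (if \<exists>v. ends (Gd 0) e = {v} then {} else ends (Gd 0) e)"
    unfolding K_def boundary_complex_def Let_def Fs Es by simp_all
qed

lemma bd2_K: "bd2 K {p} = {e \<in> base_edges w h. p \<in> e}"
proof -
  have "(\<lambda>q. {q}) ` e \<noteq> {{p}}" if e: "e \<in> base_edges w h" for e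
  proof
    assume eq: "(\<lambda>q. {q}) ` e = {{p}}"
    obtain a b where ab: "e = {a, b}" "a \<noteq> b" using e by (rule base_edgesE)
    then have "{a} \<in> {{p}}" "{b} \<in> {{p}}" unfolding eq[symmetric] by auto
    then show False using ab by simp
  qed
  then show ?thesis
    by (auto simp: K_def boundary_complex_def Let_def G_0 base_graph_def)
qed

lemma ends_Gd_0: "ends (Gd 0) e = dual_vertex w h ` sides e"
  by (simp add: Gd_0 base_dual_def)

lemma ends_Gd_0_object: "e \<in> object_edges \<Longrightarrow> ends (Gd 0) e = (\<lambda>c. {c}) ` sides e"
  unfolding ends_Gd_0 using sides_object_edge dual_vertex_inner by (intro image_cong) blast+

lemma bd1_K:
  assumes "e \<in> object_edges"
  shows "bd1 K e = (\<lambda>c. {c}) ` sides e"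
proof -
  have "e \<in> base_edges w h" using assms by simp
  then obtain c d where cd: "sides e = {c, d}" "c \<noteq> d" by (rule sides_cases)
  then have "\<not> (\<exists>v. ends (Gd 0) e = {v})"
    unfolding ends_Gd_0_object[OF assms] cd(1) by auto
  then show ?thesis by (simp add: K_simps ends_Gd_0_object[OF assms])
qed

lemma finite_object_edges: "finite object_edges"
  by simp

lemma finite_cverts_K: "finite (cverts K)"
proof -
  have "finite (sides e)" if "e \<in> base_edges w h" for e
    by (rule sides_cases[OF that]) simp
  then show ?thesis unfolding K_simps ends_Gd_0 by auto
qed

text \<open>Connects the homological notion of cycle with the one in which
  \<open>dual_acyclic\<close> is stated. Edges of the complex are no loops, so crossing
  \<open>A\<close> means having exactly one end in it.\<close>

lemma cycles1_even_cuts: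
  assumes "z \<in> cycles1 K"
  shows "even_cuts (Gd 0) z"
  unfolding even_cuts_def
proof (intro allI impI)
  fix A assume A: "A \<subseteq> verts (Gd 0)"
  have z: "z \<subseteq> object_edges" "mod2_sum (bd1 K) z = {}"
    using assms by (auto simp: cycles1_def K_simps)
  have fin: "finite A" using A wf_mgraph_finite(1)[OF wf_Gd[of 0]] finite_subset by auto
  have finz: "finite z" using z(1) finite_object_edges by (rule finite_subset)
  have "crosses (Gd 0) A e \<longleftrightarrow> odd (card (A \<inter> bd1 K e))" if "e \<in> z" for e
  proof -
    have e: "e \<in> object_edges" using that z(1) by blast
    then have "e \<in> base_edges w h" by simp
    then obtain c d where cd: "sides e = {c, d}" "c \<noteq> d" by (rule sides_cases)
    then have "bd1 K e = {{c}, {d}}" "ends (Gd 0) e = {{c}, {d}}"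
      using bd1_K[OF e] ends_Gd_0_object[OF e] by simp_all
    then show ?thesis using cd(2) by (auto simp: crosses_def odd_card_Int_pair)
  qed
  then have "{e \<in> z. crosses (Gd 0) A e} = {e \<in> z. odd (card (A \<inter> bd1 K e))}" by blast
  then show "even (card {e \<in> z. crosses (Gd 0) A e})"
    using odd_card_Int_mod2_sum[OF fin finz, of "bd1 K"] z(2) by simp
qed

text \<open>Regions are maximal: a background pixel adjacent to one belongs to it, so an edge
  leaving it must end in the object.\<close>

lemma region_boundary:
  assumes "e \<in> base_edges w h" "p0 \<in> pixels w h - F"
    and "e \<inter> region (pixels w h - F) p0 \<noteq> {}" "e - region (pixels w h - F) p0 \<noteq> {}"
  shows "e \<inter> F \<noteq> {}"
proof -
  let ?Y = "region (pixels w h - F) p0"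
  have sub: "?Y \<subseteq> pixels w h - F" by (rule region_subset[OF assms(2)])
  obtain a b where ab: "e = {a, b}" "a \<in> pixels w h" "b \<in> pixels w h" "(a, b) \<in> adj4"
    using assms(1) by (rule base_edgesE)
  have "a \<in> ?Y \<and> b \<notin> ?Y \<or> b \<in> ?Y \<and> a \<notin> ?Y" using assms(3,4) ab(1) by auto
  then show ?thesis
  proof
    assume "a \<in> ?Y \<and> b \<notin> ?Y"
    then have "b \<in> F" using region_step[of a _ p0 b] ab sub by blast
    then show ?thesis using ab by simp
  next
    assume "b \<in> ?Y \<and> a \<notin> ?Y"
    then have "a \<in> F" using region_step[of b _ p0 a] ab sub adj4_sym by blast
    then show ?thesis using ab by simp
  qed
qed

text \<open>The cocycle condition at level \<open>k\<close>. Loops are excluded because the count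
  would include a loop that contributes nothing to the mod 2 boundary, and because the descent needs
  every edge of \<open>A\<close> to join two different kernels.\<close>

definition even_at_object :: "nat \<Rightarrow> edge set \<Rightarrow> bool" where
  "even_at_object k A \<longleftrightarrow> A \<subseteq> edges (G k) \<and> (\<forall>e\<in>A. \<forall>V. ends (G k) e \<noteq> {V}) \<and>
     (\<forall>v\<in>verts (G k). v \<subseteq> F \<longrightarrow> even (card {e \<in> A. v \<in> ends (G k) e}))"

lemma even_at_object_step:
  assumes "k < n" "even_at_object (Suc k) A"
  shows "even_at_object k (A \<union> removal_part F (G k) (T k) (R k) A)"
proof -
  interpret kernels F "G k" "T k" "R k"
    using wf_G level_step(1) assms(1) by unfold_locales auto
  have ends: "ends (G (Suc k)) = ends (contract (T k) (G k))"
    and verts: "verts (G (Suc k)) = verts (contract (T k) (G k))"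
    by (simp_all add: level_step(3)[OF assms(1)])
  have A: "A \<subseteq> edges (G k) - T k"
    using assms edges_Suc by (auto simp: even_at_object_def)
  have loop: "ends (contract (T k) (G k)) e \<noteq> {V}" if "e \<in> A" for e V
    using assms(2) that unfolding even_at_object_def ends by simp
  have ev: "even (card {e \<in> A. V \<in> ends (contract (T k) (G k)) e})"
    if "V \<in> verts (contract (T k) (G k))" "V \<subseteq> F" for V
    using assms(2) that unfolding even_at_object_def ends verts by blast
  have "ends (G k) e \<noteq> {V}" if e: "e \<in> A \<union> removal A" for e V
  proof (cases "e \<in> A")
    case True
    then show ?thesis using loop[OF True, of "merged (G k) (T k) V"] by auto
  next
    case False
    then obtain u v where "arc u e v" using e mem_removal by blast
    then show ?thesis using arcD(2,3) by fastforce
  qed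
  moreover have "A \<union> removal A \<subseteq> edges (G k)"
    using A removal_subset[of A] T_subset by blast
  ultimately show ?thesis
    unfolding even_at_object_def using even_degree[OF _ _ A loop ev] by blast
qed

lemma removal_part_object:
  assumes "k < n" "e \<in> removal_part F (G k) (T k) (R k) A"
  shows "e \<in> T k \<and> e \<inter> F \<noteq> {}"
proof -
  interpret kernels F "G k" "T k" "R k"
    using wf_G level_step(1) assms(1) by unfold_locales auto
  obtain u v where u: "arc u e v" "u \<subseteq> F" using assms(2) mem_removal by blast
  have "e \<in> edges (G k)" using arcD(1)[OF u(1)] T_subset by blast
  then have "u \<inter> e \<noteq> {}"
    using ends_level[of k e] arcD(2)[OF u(1)] assms(1) by auto
  then show ?thesis using u arcD(1)[OF u(1)] by blast
qed

text \<open>The induction varies \<open>A\<close>, since the recursion enlarges the set before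
  descending. The upper bound by kernel edges is what later separates the projected cocycles from
  the hole cuts.\<close>

lemma cocycle_down_projection_props:
  "k \<le> n \<Longrightarrow> even_at_object k A \<Longrightarrow>
    even_at_object 0 (cocycle_down_projection F G T R k A) \<and>
    A \<subseteq> cocycle_down_projection F G T R k A \<and>
    cocycle_down_projection F G T R k A \<subseteq> A \<union> {e \<in> \<Union>j<k. T j. e \<inter> F \<noteq> {}}"
proof (induction k arbitrary: A)
  case (Suc k)
  then have k: "k < n" "k \<le> n" by auto
  let ?B = "A \<union> removal_part F (G k) (T k) (R k) A"
  have IH: "even_at_object 0 (cocycle_down_projection F G T R k ?B) \<and>
    ?B \<subseteq> cocycle_down_projection F G T R k ?B \<and>
    cocycle_down_projection F G T R k ?B \<subseteq> ?B \<union> {e \<in> \<Union>j<k. T j. e \<inter> F \<noteq> {}}"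
    by (rule Suc.IH[OF k(2) even_at_object_step[OF k(1) Suc.prems(2)]])
  have "?B \<subseteq> A \<union> {e \<in> \<Union>j<Suc k. T j. e \<inter> F \<noteq> {}}"
    using removal_part_object[OF k(1)] by blast
  moreover have "{e \<in> \<Union>j<k. T j. e \<inter> F \<noteq> {}} \<subseteq> {e \<in> \<Union>j<Suc k. T j. e \<inter> F \<noteq> {}}"
    by auto
  ultimately have "cocycle_down_projection F G T R k ?B \<subseteq> A \<union> {e \<in> \<Union>j<Suc k. T j. e \<inter> F \<noteq> {}}"
    using IH by blast
  then show ?case using IH by simp
qed simp

lemma even_at_object_0_cocycle:
  assumes "even_at_object 0 A" "A \<subseteq> object_edges"
  shows "A \<in> cocycles1 K"
proof -
  have "even (card (A \<inter> bd2 K f))" if f: "f \<in> cfaces K" for f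
  proof -
    obtain p where p: "f = {p}" "p \<in> F" using f by (auto simp: K_simps)
    then have "{p} \<in> verts (G 0)" using F_pixels by (auto simp: G_0 base_graph_def)
    then have "even (card {e \<in> A. {p} \<in> ends (G 0) e})"
      using assms(1) p by (simp add: even_at_object_def)
    moreover have "{e \<in> A. {p} \<in> ends (G 0) e} = A \<inter> bd2 K f"
      unfolding p(1) bd2_K using assms(2) by (auto simp: G_0 base_graph_def)
    ultimately show ?thesis by simp
  qed
  then show ?thesis using assms(2) by (simp add: cocycles1_def coboundary1_def K_simps)
qed

end

section \<open>The homology-generator level and the star of top edges\<close>

locale generators = pyramid +
  fixes m :: nat and Z :: "edge set" and Hole :: "nat \<Rightarrow> point set"
    and \<alpha> :: "nat \<Rightarrow> edge" and \<beta> :: edge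
  assumes tree: "spanning_tree (Gd n) Z"
    and Hole: "bij_betw Hole {1..m} (holes w h F)"
    and \<alpha>: "i \<in> {1..m} \<Longrightarrow> \<alpha> i \<in> edges (G n) - Z \<and> ends (G n) (\<alpha> i) = {F, Hole i}"
    and \<beta>: "\<beta> \<in> edges (G n) - Z \<and> ends (G n) \<beta> = {F, outside w h F}"
begin

abbreviation "C \<equiv> dual_contracted Z 0"
abbreviation "U \<equiv> \<Union>k<n. T k"
abbreviation "L \<equiv> edges (G n) - Z"
abbreviation "bg \<equiv> pixels w h - F"

lemma Z_subset: "Z \<subseteq> edges (G n)"
  using tree edges_Gd[of n] by (simp add: spanning_tree_def forest_def)

lemma cover: "base_edges w h = U \<union> C \<union> L"
  using base_edges_cover[OF Z_subset] .

lemma UC: "U \<inter> C = {}" and UL: "U \<inter> L = {}" and LC: "L \<inter> C = {}"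
  using T_disjoint[OF Z_subset] edges_n_disjoint[of Z] by auto

text \<open>
  A cycle of the pixel graph is a cut of the dual graph, which the tree \<open>C\<close> would have to cross.
\<close>

lemma no_cycle:
  assumes "z \<subseteq> U \<union> L" "mod2_sum (\<lambda>e. e) z = {}"
  shows "z = {}"
proof -
  have z: "z \<subseteq> base_edges w h" using assms(1) cover by blast
  obtain A where A: "A \<subseteq> {0<..<w} \<times> {0<..<h}"
    and cut: "\<And>e. e \<in> base_edges w h \<Longrightarrow> e \<in> z \<longleftrightarrow> odd (card (A \<inter> sides e))"
    using grid_cycle_is_dual_cut[OF z assms(2)] by metis
  define B where "B = (\<lambda>c. {c}) ` A"
  \<comment> \<open>As \<open>A\<close> avoids the rim, collapsing the rim does not blur membership,
    and \<open>B\<close> is a genuine vertex set of the dual graph.\<close>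
  have mem: "dual_vertex w h c \<in> B \<longleftrightarrow> c \<in> A" if c: "c \<in> {..w} \<times> {..h}" for c
  proof
    assume "dual_vertex w h c \<in> B"
    then obtain d where d: "d \<in> A" "dual_vertex w h c = {d}" by (auto simp: B_def)
    then show "c \<in> A" using dual_vertex_mem[OF c] by simp
  next
    assume "c \<in> A"
    then show "dual_vertex w h c \<in> B" using dual_vertex_inner A by (auto simp: B_def)
  qed
  have "A = {}"
  proof (rule ccontr)
    assume "A \<noteq> {}"
    then obtain c where c: "c \<in> A" by blast
    then have inner: "c \<in> {0<..<w} \<times> {0<..<h}" using A by blast
    then have "c \<in> {..w} \<times> {..h}" by auto
    then have "dual_vertex w h c \<in> verts (Gd 0)" by (simp add: Gd_0 base_dual_def)
    then have cv: "{c} \<in> verts (Gd 0)" "{c} \<in> B"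
      using dual_vertex_inner[OF inner] c by (simp_all add: B_def)
    have ov: "dual_vertex w h (0, 0) \<in> verts (Gd 0)" by (simp add: Gd_0 base_dual_def)
    have "({c}, dual_vertex w h (0, 0)) \<in> joined (Gd 0) C"
      using dual_connected[OF tree, of 0] cv(1) ov by (simp add: connected_by_def)
    \<comment> \<open>The point (0, 0) lies on the rim and represents the unbounded face. Membership
      in \<open>B\<close> is constant along the tree path, because edges of \<open>C\<close> are not
      in \<open>z\<close> and hence do not cross the cut.\<close>
    then have "dual_vertex w h (0, 0) \<in> B"
    proof (induction rule: joined_induct)
      case (step u v e)
      have "e \<notin> U" "e \<notin> L" using step.hyps(2) UC LC by (meson disjoint_iff)+
      then have e: "e \<in> base_edges w h" "e \<notin> z"
        using step.hyps(2) assms(1) by (auto simp: cover)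
      obtain a b where ab: "sides e = {a, b}" "a \<noteq> b" "a \<in> {..w} \<times> {..h}" "b \<in> {..w} \<times> {..h}"
        using e(1) by (rule sides_cases)
      then have "a \<in> A \<longleftrightarrow> b \<in> A" using cut[OF e(1)] e(2) odd_card_Int_pair[of a b A] by simp
      then have "dual_vertex w h a \<in> B \<longleftrightarrow> dual_vertex w h b \<in> B" using mem ab by simp
      moreover have "{u, v} = {dual_vertex w h a, dual_vertex w h b}"
        using step.hyps(3) ab(1) by (simp add: ends_Gd_0)
      ultimately show ?case using step.IH by (auto simp: doubleton_eq_iff)
    qed (rule cv(2))
    then have "(0, 0) \<in> A" using mem[of "(0, 0)"] by simp
    then show False using A by auto
  qed
  then have "e \<notin> z" if "e \<in> base_edges w h" for e using cut[OF that] by simp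
  then show ?thesis using z by blast
qed

text \<open>Such a walk would close up with \<open>e\<close> to a mod 2 cycle, which is nonempty
  because \<open>e\<close> itself cannot cancel.\<close>

lemma no_path:
  assumes "e \<in> L" "e = {p, q}" "p \<noteq> q"
  shows "(p, q) \<notin> {(a, b). a \<noteq> b \<and> {a, b} \<in> U \<union> L - {e}}\<^sup>*"
proof
  assume "(p, q) \<in> {(a, b). a \<noteq> b \<and> {a, b} \<in> U \<union> L - {e}}\<^sup>*"
  then obtain x where x: "finite x" "x \<subseteq> U \<union> L - {e}" "mod2_sum (\<lambda>e. e) x = sym_diff {p} {q}"
    by (rule rtrancl_edge_chain)
  have "mod2_sum (\<lambda>e. e) (insert e x) = {}"
    using x assms by (subst mod2_sum_insert) auto
  then have "insert e x = {}" using x(2) assms(1) by (intro no_cycle) auto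
  then show False by simp
qed

lemma L_edge:
  assumes "e \<in> L"
  obtains p q where "e = {p, q}" "p \<noteq> q" "p \<in> pixels w h" "q \<in> pixels w h"
  using assms cover base_edgesE[of e w h] by blast

lemma ends_L: "e \<in> L \<Longrightarrow> ends (G n) e = {v \<in> verts (G n). v \<inter> e \<noteq> {}}"
  using ends_level[of n e] by simp

lemma same_vertex_path:
  assumes "V \<in> verts (G n)" "p \<in> V" "q \<in> V" "e \<in> L"
  shows "(p, q) \<in> {(a, b). a \<noteq> b \<and> {a, b} \<in> U \<union> L - {e}}\<^sup>*"
proof -
  have "(p, q) \<in> {(a, b). a \<noteq> b \<and> {a, b} \<in> U}\<^sup>*" by (rule verts_level(3)[OF order_refl assms(1-3)])
  moreover have "{(a, b). a \<noteq> b \<and> {a, b} \<in> U} \<subseteq> {(a, b). a \<noteq> b \<and> {a, b} \<in> U \<union> L - {e}}"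
    using UL assms(4) by blast
  ultimately show ?thesis using rtrancl_mono by blast
qed

lemma L_no_loop:
  assumes "e \<in> L"
  shows "ends (G n) e \<noteq> {V}"
proof
  assume eq: "ends (G n) e = {V}"
  obtain p q where e: "e = {p, q}" "p \<noteq> q" "p \<in> pixels w h" "q \<in> pixels w h"
    using assms by (rule L_edge)
  obtain u v where u: "u \<in> verts (G n)" "p \<in> u" and v: "v \<in> verts (G n)" "q \<in> v"
    using verts_cover[OF order_refl] e by meson
  then have "u \<in> ends (G n) e" "v \<in> ends (G n) e" using ends_L[OF assms] e(1) by blast+
  then have "u = V" "v = V" unfolding eq by simp_all
  then show False using no_path[OF assms e(1,2)] same_vertex_path[OF u(1) u(2) _ assms] v by simp
qed

text \<open>For parallel edges, walk from \<open>p\<close> inside \<open>u\<close> to an end of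
  \<open>e'\<close>, across \<open>e'\<close>, and inside \<open>v\<close> to \<open>q\<close>. This
  avoids \<open>e\<close> and contradicts \<open>no_path\<close>.\<close>

lemma L_ends_inj:
  assumes "e \<in> L" "e' \<in> L" "ends (G n) e = ends (G n) e'"
  shows "e = e'"
proof (rule ccontr)
  assume neq: "e \<noteq> e'"
  obtain p q where e: "e = {p, q}" "p \<noteq> q" "p \<in> pixels w h" "q \<in> pixels w h"
    using assms(1) by (rule L_edge)
  obtain u v where u: "u \<in> verts (G n)" "p \<in> u" and v: "v \<in> verts (G n)" "q \<in> v"
    using verts_cover[OF order_refl] e by meson
  have "u \<in> ends (G n) e'" "v \<in> ends (G n) e'"
    using ends_L[OF assms(1)] e(1) u v unfolding assms(3)[symmetric] by blast+
  then have "u \<inter> e' \<noteq> {}" "v \<inter> e' \<noteq> {}" using ends_L[OF assms(2)] by blast+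
  then obtain p' q' where p': "p' \<in> u" "p' \<in> e'" and q': "q' \<in> v" "q' \<in> e'" by blast
  obtain a b where "e' = {a, b}" "a \<noteq> b" using assms(2) by (rule L_edge)
  then have "p' = q' \<or> p' \<noteq> q' \<and> {p', q'} = e'" using p'(2) q'(2) by auto
  then have "(p', q') \<in> {(a, b). a \<noteq> b \<and> {a, b} \<in> U \<union> L - {e}}\<^sup>*"
  proof
    assume "p' \<noteq> q' \<and> {p', q'} = e'"
    then have "(p', q') \<in> {(a, b). a \<noteq> b \<and> {a, b} \<in> U \<union> L - {e}}" using assms(2) neq by simp
    then show ?thesis by (rule r_into_rtrancl)
  qed simp
  then have "(p, q) \<in> {(a, b). a \<noteq> b \<and> {a, b} \<in> U \<union> L - {e}}\<^sup>*"
    using same_vertex_path[OF u p'(1) assms(1)] same_vertex_path[OF v(1) q'(1) v(2) assms(1)]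
    by (meson rtrancl_trans)
  then show False using no_path[OF assms(1) e(1,2)] by simp
qed

lemma Hole_mem: "i \<in> {1..m} \<Longrightarrow> Hole i \<in> holes w h F"
  using Hole bij_betwE by blast

lemma region_cases:
  assumes "p \<in> bg"
  shows "region bg p = outside w h F \<or> (\<exists>i\<in>{1..m}. region bg p = Hole i)"
proof -
  have "region bg p \<in> holes w h F \<or> region bg p = outside w h F"
    using assms by (auto simp: holes_def)
  then show ?thesis using Hole unfolding bij_betw_def by blast
qed

lemma region_Hole:
  assumes "i \<in> {1..m}"
  obtains p where "p \<in> bg" "Hole i = region bg p"
  using Hole_mem[OF assms] by (auto simp: holes_def)

lemma Hole_F: "i \<in> {1..m} \<Longrightarrow> Hole i \<inter> F = {}"
  using region_Hole[of i] region_subset[of _ bg] by (metis Diff_disjoint Int_commute disjoint_iff subsetD)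

text \<open>\<open>F\<close>, the holes and the outside occur as ends of the \<alpha> i and \<beta>,
  so each is one whole receptive field. Since vertices are disjoint, any vertex sharing a pixel with
  one of them equals it.\<close>

lemma verts_n: "F \<in> verts (G n)" "outside w h F \<in> verts (G n)" "i \<in> {1..m} \<Longrightarrow> Hole i \<in> verts (G n)"
  using \<beta> \<alpha> wf_mgraph_ends_subset[OF wf_G[OF order_refl]] by (metis DiffD1 insert_subset)+

lemma Hole_neq:
  assumes "i \<in> {1..m}"
  shows "Hole i \<noteq> F" "Hole i \<noteq> outside w h F"
  using Hole_F[OF assms] wf_mgraph_nonempty[OF wf_G[OF order_refl] verts_n(1)] Hole_mem[OF assms]
  by (auto simp: holes_def)

text \<open>At termination an edge that is no loop joins an object vertex to a background vertex.
  These can only be \<open>F\<close> and a hole or the outside, and \<open>L_ends_inj\<close>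
  identifies the edge by its ends.\<close>

lemma L_classified:
  assumes "e \<in> L"
  shows "e = \<beta> \<or> (\<exists>i\<in>{1..m}. e = \<alpha> i)"
proof -
  have eG: "e \<in> edges (G n)" using assms by simp
  note disj = wf_mgraph_disjoint[OF wf_G[OF order_refl]]
  note nonempty = wf_mgraph_nonempty[OF wf_G[OF order_refl]]
  obtain u v where uv: "u \<in> verts (G n)" "v \<in> verts (G n)" "ends (G n) e = {u, v}"
    using wf_G[OF order_refl] eG by (rule wf_mgraph_endsE)
  have "u \<noteq> v" using L_no_loop[OF assms, of u] uv(3) by auto
  moreover have "\<forall>e\<in>edges (G n). \<forall>u v. ends (G n) e = {u, v} \<and> u \<noteq> v \<longrightarrow> \<not> (u \<subseteq> F \<longleftrightarrow> v \<subseteq> F)"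
    using pyramid by (simp add: graph_pyramid_def)
  ultimately have "\<not> (u \<subseteq> F \<longleftrightarrow> v \<subseteq> F)" using eG uv(3) by blast
  then consider "u \<subseteq> F" "\<not> v \<subseteq> F" | "v \<subseteq> F" "\<not> u \<subseteq> F" by blast
  then obtain a b where ab: "a \<in> verts (G n)" "b \<in> verts (G n)" "ends (G n) e = {a, b}"
      "a \<subseteq> F" "\<not> b \<subseteq> F"
  proof cases
    case 1
    then show ?thesis using that uv by blast
  next
    case 2
    then show ?thesis using that[of v u] uv by (simp add: insert_commute)
  qed
  have a: "a = F"
  proof -
    obtain p where "p \<in> a" using nonempty[OF ab(1)] by blast
    then show ?thesis using disj[OF ab(1) verts_n(1)] ab(4) by blast
  qed
  have b: "b = outside w h F \<or> (\<exists>i\<in>{1..m}. b = Hole i)"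
  proof -
    obtain p where p: "p \<in> b" using nonempty[OF ab(2)] by blast
    then have "p \<in> bg"
      using verts_level(1,2)[OF order_refl ab(2)] ab(5) by blast
    from region_cases[OF this] show ?thesis
    proof
      assume "region bg p = outside w h F"
      then have "p \<in> outside w h F" using region_refl[of p bg] by simp
      then show ?thesis using disj[OF ab(2) verts_n(2) p] by simp
    next
      assume "\<exists>i\<in>{1..m}. region bg p = Hole i"
      then obtain i where i: "i \<in> {1..m}" "region bg p = Hole i" by blast
      then have "p \<in> Hole i" using region_refl[of p bg] by simp
      then show ?thesis using disj[OF ab(2) verts_n(3)[OF i(1)] p] i(1) by blast
    qed
  qed
  then show ?thesis
  proof
    assume "b = outside w h F"
    then have "e = \<beta>" using \<beta> ab(3) a by (intro L_ends_inj[OF assms]) simp_all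
    then show ?thesis by simp
  next
    assume "\<exists>i\<in>{1..m}. b = Hole i"
    then obtain i where i: "i \<in> {1..m}" "b = Hole i" by blast
    then have "e = \<alpha> i" using \<alpha>[OF i(1)] ab(3) a by (intro L_ends_inj[OF assms]) simp_all
    then show ?thesis using i by blast
  qed
qed

lemma \<alpha>_neq_\<beta>:
  assumes "i \<in> {1..m}"
  shows "\<alpha> i \<noteq> \<beta>"
proof
  assume "\<alpha> i = \<beta>"
  then have "{F, Hole i} = {F, outside w h F}" using \<alpha>[OF assms] \<beta> by simp
  then show False using Hole_neq[OF assms] by (auto simp: doubleton_eq_iff)
qed

text \<open>The mod 2 boundary of the hole as a union of pixels; it turns out to be the projected
  cycle.\<close>

definition hole_cut :: "nat \<Rightarrow> edge set" where
  "hole_cut i = {e \<in> base_edges w h. e \<inter> Hole i \<noteq> {} \<and> e - Hole i \<noteq> {}}"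

lemma hole_cut_odd: "hole_cut i = {e \<in> base_edges w h. odd (card (Hole i \<inter> e))}"
  unfolding hole_cut_def using odd_card_Int_base_edge[of _ w h "Hole i"] by blast

lemma finite_object_subset: "z \<subseteq> object_edges \<Longrightarrow> finite z"
  using finite_object_edges by (rule finite_subset[rotated])

lemma hole_cut_object:
  assumes "i \<in> {1..m}"
  shows "hole_cut i \<subseteq> object_edges"
proof
  fix e assume e: "e \<in> hole_cut i"
  obtain p where "p \<in> bg" "Hole i = region bg p" using region_Hole[OF assms] .
  then show "e \<in> object_edges" using e region_boundary[of e p] by (simp add: hole_cut_def)
qed

lemma finite_hole_cut: "finite (hole_cut i)"
  by (simp add: hole_cut_def)

lemma hole_cut_cycle:
  assumes "i \<in> {1..m}"
  shows "hole_cut i \<in> cycles1 K"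
proof -
  have "even (card {e \<in> hole_cut i. x \<in> bd1 K e})" for x
  proof (cases "\<exists>c \<in> {0<..<w} \<times> {0<..<h}. x = {c}")
    case True
    then obtain a b where ab: "0 < a" "a < w" "0 < b" "b < h" "x = {(a, b)}" by auto
    have "x \<in> bd1 K e \<longleftrightarrow> (a, b) \<in> sides e" if "e \<in> hole_cut i" for e
    proof -
      have "e \<in> object_edges" using that hole_cut_object[OF assms] by blast
      then have "bd1 K e = (\<lambda>c. {c}) ` sides e" by (rule bd1_K)
      then show ?thesis unfolding ab(5) by blast
    qed
    then have "{e \<in> hole_cut i. x \<in> bd1 K e} =
        {e \<in> base_edges w h. (a, b) \<in> sides e \<and> odd (card (Hole i \<inter> e))}"
      unfolding hole_cut_odd by blast
    then show ?thesis using grid_cut_even_at_corner[OF ab(1-4), of "Hole i"] by simp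
  next
    case False
    have "x \<notin> bd1 K e" if "e \<in> hole_cut i" for e
    proof -
      have "e \<in> object_edges" using that hole_cut_object[OF assms] by blast
      then have "bd1 K e = (\<lambda>c. {c}) ` sides e" "sides e \<subseteq> {0<..<w} \<times> {0<..<h}"
        by (rule bd1_K, rule sides_object_edge)
      then show ?thesis using False by (auto simp only: image_iff)
    qed
    then have "{e \<in> hole_cut i. x \<in> bd1 K e} = {}" by blast
    then show ?thesis by (simp only: card.empty even_zero)
  qed
  then have "mod2_sum (bd1 K) (hole_cut i) = {}" unfolding mod2_sum_def by simp
  then show ?thesis using hole_cut_object[OF assms] by (simp add: cycles1_def K_simps)
qed

lemma \<alpha>_meets: "i \<in> {1..m} \<Longrightarrow> \<alpha> i \<inter> F \<noteq> {}" and \<beta>_meets: "\<beta> \<inter> F \<noteq> {}"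
proof -
  have "e \<inter> F \<noteq> {}" if "e \<in> L" "F \<in> ends (G n) e" for e
    using that(2) unfolding ends_L[OF that(1)] by auto
  then show "i \<in> {1..m} \<Longrightarrow> \<alpha> i \<inter> F \<noteq> {}" "\<beta> \<inter> F \<noteq> {}" using \<alpha> \<beta> by simp_all
qed

lemma \<alpha>_hole_cut:
  assumes "i \<in> {1..m}"
  shows "\<alpha> i \<in> hole_cut i"
proof -
  have "\<alpha> i \<in> L" using \<alpha>[OF assms] by simp
  have "Hole i \<in> ends (G n) (\<alpha> i)" using \<alpha>[OF assms] by simp
  then have "Hole i \<inter> \<alpha> i \<noteq> {}" unfolding ends_L[OF \<open>\<alpha> i \<in> L\<close>] by simp
  moreover have "\<alpha> i - Hole i \<noteq> {}" using \<alpha>_meets[OF assms] Hole_F[OF assms] by blast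
  moreover have "\<alpha> i \<in> base_edges w h" using \<open>\<alpha> i \<in> L\<close> unfolding cover by blast
  ultimately show ?thesis by (auto simp: hole_cut_def)
qed

lemma L_not_hole_cut:
  assumes "i \<in> {1..m}" "e \<in> L" "Hole i \<notin> ends (G n) e"
  shows "e \<notin> hole_cut i"
  using ends_L[OF assms(2)] assms(3) verts_n(3)[OF assms(1)] by (auto simp: hole_cut_def)

lemma \<beta>_hole_cut: "i \<in> {1..m} \<Longrightarrow> \<beta> \<notin> hole_cut i"
  using L_not_hole_cut[of i \<beta>] \<beta> Hole_neq[of i] by auto

lemma \<alpha>_not_hole_cut:
  assumes "i \<in> {1..m}" "j \<in> {1..m}" "i \<noteq> j"
  shows "\<alpha> j \<notin> hole_cut i"
proof (rule L_not_hole_cut[OF assms(1)])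
  have "Hole i \<noteq> Hole j" using Hole assms unfolding bij_betw_def by (metis inj_onD)
  then show "Hole i \<notin> ends (G n) (\<alpha> j)" using \<alpha>[OF assms(2)] Hole_neq[OF assms(1)] by auto
  show "\<alpha> j \<in> L" using \<alpha>[OF assms(2)] by simp
qed

text \<open>Kernel edges never mix labels, whereas an edge leaving a hole ends at an object
  pixel.\<close>

lemma U_hole_cut:
  assumes "i \<in> {1..m}" "e \<in> U"
  shows "e \<notin> hole_cut i"
proof
  assume e: "e \<in> hole_cut i"
  then have "e \<inter> F \<noteq> {}" "e \<inter> Hole i \<noteq> {}"
    using hole_cut_object[OF assms(1)] by (auto simp: hole_cut_def)
  then obtain p q where "p \<in> e" "p \<in> F" "q \<in> e" "q \<in> Hole i" by blast
  moreover obtain k where "k < n" "e \<in> T k" using assms(2) by blast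
  ultimately have "q \<in> F" using T_same_label by blast
  with \<open>q \<in> Hole i\<close> show False using Hole_F[OF assms(1)] by blast
qed

lemma hole_cut_contracted:
  assumes "i \<in> {1..m}"
  shows "hole_cut i \<subseteq> insert (\<alpha> i) C"
proof
  fix e assume e: "e \<in> hole_cut i"
  then have "e \<in> U \<union> C \<union> L" using cover by (simp add: hole_cut_def)
  moreover have "e \<notin> U" using U_hole_cut[OF assms] e by blast
  moreover have "e = \<alpha> i" if "e \<in> L"
    using L_classified[OF that] \<beta>_hole_cut[OF assms] \<alpha>_not_hole_cut[OF assms] e by blast
  ultimately show "e \<in> insert (\<alpha> i) C" by blast
qed

text \<open>The definite description requires uniqueness: two candidates share \<alpha> i, so their
  sum is a cycle inside the dual tree \<open>C\<close> and vanishes.\<close>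

lemma cycle_down_projection_eq:
  assumes i: "i \<in> {1..m}"
  shows "cycle_down_projection K (contracted_edges n Gd T S Z) (\<alpha> i) = hole_cut i"
  unfolding cycle_down_projection_def contracted_edges_eq
proof (rule the_equality)
  show "hole_cut i \<in> cycles1 K \<and> \<alpha> i \<in> hole_cut i \<and> hole_cut i - {\<alpha> i} \<subseteq> C"
    using hole_cut_cycle[OF i] \<alpha>_hole_cut[OF i] hole_cut_contracted[OF i] by blast
next
  fix z assume z: "z \<in> cycles1 K \<and> \<alpha> i \<in> z \<and> z - {\<alpha> i} \<subseteq> C"
  let ?y = "sym_diff z (hole_cut i)"
  have zo: "z \<subseteq> object_edges" "mod2_sum (bd1 K) z = {}"
    using z by (auto simp: cycles1_def K_simps)
  then have fin: "finite z" using finite_object_edges finite_subset by blast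
  have "mod2_sum (bd1 K) ?y = {}"
    using hole_cut_cycle[OF i] zo by (subst mod2_sum_sym_diff[OF fin finite_hole_cut]) (simp add: cycles1_def)
  moreover have "?y \<subseteq> object_edges" using zo(1) hole_cut_object[OF i] by blast
  ultimately have "?y \<in> cycles1 K" by (simp add: cycles1_def K_simps)
  moreover have "?y \<subseteq> C" using z hole_cut_contracted[OF i] \<alpha>_hole_cut[OF i] by blast
  ultimately have "?y = {}" by (intro dual_acyclic[OF tree, of 0] cycles1_even_cuts) simp_all
  then show "z = hole_cut i" by blast
qed

section \<open>Projected cocycles and their pairing with the hole cuts\<close>

abbreviation "co i \<equiv> cocycle_down_projection F G T R n {\<alpha> i, \<beta>}"

text \<open>\<open>F\<close> is the only object vertex of the top level and both edges end there.
  This is why \<beta> accompanies \<alpha> i: a single edge would have odd degree at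
  \<open>F\<close>.\<close>

lemma even_at_object_top:
  assumes i: "i \<in> {1..m}"
  shows "even_at_object n {\<alpha> i, \<beta>}"
  unfolding even_at_object_def
proof (intro conjI ballI allI impI)
  show "{\<alpha> i, \<beta>} \<subseteq> edges (G n)" using \<alpha>[OF i] \<beta> by simp
  show "ends (G n) e \<noteq> {V}" if "e \<in> {\<alpha> i, \<beta>}" for e V
    using L_no_loop[of e V] that \<alpha>[OF i] \<beta> by auto
  fix v assume v: "v \<in> verts (G n)" "v \<subseteq> F"
  obtain p where "p \<in> v" using wf_mgraph_nonempty[OF wf_G[OF order_refl] v(1)] by blast
  then have "v = F" using wf_mgraph_disjoint[OF wf_G[OF order_refl] v(1) verts_n(1)] v(2) by blast
  then have "{e \<in> {\<alpha> i, \<beta>}. v \<in> ends (G n) e} = {\<alpha> i, \<beta>}" using \<alpha>[OF i] \<beta> by auto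
  then show "even (card {e \<in> {\<alpha> i, \<beta>}. v \<in> ends (G n) e})" using \<alpha>_neq_\<beta>[OF i] by simp
qed

lemma co_props:
  assumes i: "i \<in> {1..m}"
  shows "{\<alpha> i, \<beta>} \<subseteq> co i" "co i \<subseteq> {\<alpha> i, \<beta>} \<union> {e \<in> U. e \<inter> F \<noteq> {}}" "even_at_object 0 (co i)"
  using cocycle_down_projection_props[OF order_refl even_at_object_top[OF i]] by auto

lemma co_object:
  assumes i: "i \<in> {1..m}"
  shows "co i \<subseteq> object_edges"
proof -
  have "{\<alpha> i, \<beta>} \<union> {e \<in> U. e \<inter> F \<noteq> {}} \<subseteq> object_edges"
    using \<alpha>_meets[OF i] \<beta>_meets \<alpha>[OF i] \<beta> by (auto simp: cover)
  then show ?thesis using co_props(2)[OF i] by (rule subset_trans[rotated])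
qed

lemma finite_co: "i \<in> {1..m} \<Longrightarrow> finite (co i)"
  using co_object finite_object_edges finite_subset by blast

lemma co_cocycle: "i \<in> {1..m} \<Longrightarrow> co i \<in> cocycles1 K"
  using even_at_object_0_cocycle co_props(3) co_object by blast

text \<open>The pairing matrix is the identity: a hole cut avoids \<open>U\<close>, \<beta> and the
  edges of the other holes, which leaves only \<alpha> j.\<close>

lemma hole_cut_Int_co:
  assumes "i \<in> {1..m}" "j \<in> {1..m}"
  shows "hole_cut i \<inter> co j = (if i = j then {\<alpha> i} else {})"
proof -
  have "e = \<alpha> j" if "e \<in> hole_cut i" "e \<in> co j" for e
  proof -
    have "e \<in> {\<alpha> j, \<beta>} \<union> {e \<in> U. e \<inter> F \<noteq> {}}" using co_props(2)[OF assms(2)] that(2) by (rule subsetD)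
    moreover have "e \<notin> U" using U_hole_cut[OF assms(1)] that(1) by metis
    moreover have "e \<noteq> \<beta>" using \<beta>_hole_cut[OF assms(1)] that(1) by metis
    ultimately show ?thesis by simp
  qed
  then have "hole_cut i \<inter> co j \<subseteq> {\<alpha> j} \<inter> hole_cut i" by blast
  then show ?thesis
    using \<alpha>_hole_cut[OF assms(1)] \<alpha>_not_hole_cut[OF assms] co_props(1)[OF assms(1)]
    by (cases "i = j") auto
qed

lemma odd_hole_cut_Int_co:
  "i \<in> {1..m} \<Longrightarrow> j \<in> {1..m} \<Longrightarrow> odd (card (hole_cut i \<inter> co j)) \<longleftrightarrow> i = j"
  by (simp add: hole_cut_Int_co)

lemma cocycle_Int_boundary:
  assumes "c \<in> cocycles1 K" "X \<subseteq> cfaces K"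
  shows "even (card (c \<inter> mod2_sum (bd2 K) X))"
proof -
  have "finite c" using assms(1) by (intro finite_object_subset) (simp add: cocycles1_def K_simps)
  moreover have "finite X"
    using assms(2) finite_subset[OF F_pixels] finite_subset[of X "cfaces K"] by (simp add: K_simps)
  moreover have "{f \<in> X. odd (card (c \<inter> bd2 K f))} = {}"
    using assms by (auto simp: cocycles1_def coboundary1_def)
  ultimately show ?thesis
    using odd_card_Int_mod2_sum[of c X "bd2 K"] by (simp only: card.empty even_zero simp_thms)
qed

lemma cycle_Int_coboundary:
  assumes "z \<in> cycles1 K" "b \<in> coboundaries1 K"
  shows "even (card (z \<inter> b))"
proof -
  obtain a where a: "a \<subseteq> cverts K" "b = coboundary0 K a" using assms(2) by (auto simp: coboundaries1_def)
  have z: "z \<subseteq> cedges K" "mod2_sum (bd1 K) z = {}" using assms(1) by (auto simp: cycles1_def)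
  have "finite a" using a(1) finite_cverts_K finite_subset by blast
  moreover have "finite z" using z(1) by (intro finite_object_subset) (simp add: K_simps)
  ultimately have "even (card {e \<in> z. odd (card (a \<inter> bd1 K e))})"
    using odd_card_Int_mod2_sum[of a z "bd1 K"] z(2) by simp
  moreover have "{e \<in> z. odd (card (a \<inter> bd1 K e))} = z \<inter> b"
    unfolding a(2) coboundary0_def using z(1) by blast
  ultimately show ?thesis by simp
qed

text \<open>A cocycle meets every boundary evenly, so the parity depends only on the homology class
  of \<open>g\<close>. On the hole cut it is decided by the single common edge \<alpha> i.\<close>

lemma co_blocks_hole:
  assumes i: "i \<in> {1..m}" and g: "g \<in> cycles1 K" "homologous1 K g (hole_cut i)"
  shows "odd (card (co i \<inter> g))"
proof -
  obtain X where X: "X \<subseteq> cfaces K" "sym_diff g (hole_cut i) = mod2_sum (bd2 K) X"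
    using g(2) by (auto simp: homologous1_def)
  have "even (card (co i \<inter> sym_diff g (hole_cut i)))"
    unfolding X(2) by (rule cocycle_Int_boundary[OF co_cocycle[OF i] X(1)])
  then have "odd (card (co i \<inter> g)) \<longleftrightarrow> odd (card (co i \<inter> hole_cut i))"
    using odd_card_Int_sym_diff[OF finite_co[OF i]] by blast
  also have "co i \<inter> hole_cut i = {\<alpha> i}" using hole_cut_Int_co[OF i i] by auto
  finally show ?thesis by simp
qed

text \<open>Existence of a T-join: a set that is even in every background region is paired off
  inside the regions, and the paths joining the pairs are added mod 2. Each induction step removes
  one pair.\<close>

lemma region_even_join:
  assumes "finite Q" "Q \<subseteq> bg" "\<And>p. p \<in> bg \<Longrightarrow> even (card (region bg p \<inter> Q))"
  shows "\<exists>x\<subseteq>{e \<in> base_edges w h. e \<inter> F = {}}. mod2_sum (\<lambda>e. e) x = Q"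
  using assms
proof (induction "card Q" arbitrary: Q rule: less_induct)
  case less
  show ?case
  proof (cases "Q = {}")
    case True
    then show ?thesis by (intro exI[of _ "{}"]) simp
  next
    case False
    then obtain p where p: "p \<in> Q" by blast
    let ?Y = "region bg p"
    have "even (card (?Y \<inter> Q))" using less.prems(2,3) p by blast
    then have "?Y \<inter> Q \<noteq> {p}" by auto
    then obtain q where q: "q \<in> ?Y" "q \<in> Q" "q \<noteq> p" using p region_refl[of p bg] by blast
    define Q' where "Q' = Q - {p, q}"
    have sd: "Q = sym_diff Q' {p, q}" using p q by (auto simp: Q'_def)
    have fin: "finite Q'" using less.prems(1) by (simp add: Q'_def)
    have "even (card (region bg r \<inter> Q'))" if r: "r \<in> bg" for r
    proof -
      have "p \<in> region bg r \<longleftrightarrow> q \<in> region bg r"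
      proof
        assume "p \<in> region bg r"
        then show "q \<in> region bg r" using region_eq[of p bg r] q(1) by simp
      next
        assume "q \<in> region bg r"
        then have "?Y = region bg r" using region_eq[of q bg r] region_eq[OF q(1)] by simp
        then show "p \<in> region bg r" using region_refl[of p bg] by simp
      qed
      then have "even (card (region bg r \<inter> {p, q}))" using q(3) odd_card_Int_pair[of p q] by metis
      moreover have "finite (region bg r)"
        using region_subset[OF r] finite_subset[of _ bg] by simp
      moreover have "even (card (region bg r \<inter> sym_diff Q' {p, q}))"
        using less.prems(3)[OF r] sd by simp
      ultimately show ?thesis using odd_card_Int_sym_diff[of "region bg r" Q' "{p, q}"] by blast
    qed
    moreover have "card Q' < card Q"
      unfolding Q'_def using less.prems(1) p by (intro psubset_card_mono) auto
    moreover have "Q' \<subseteq> bg" using less.prems(2) by (auto simp: Q'_def)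
    ultimately obtain x where x: "x \<subseteq> {e \<in> base_edges w h. e \<inter> F = {}}" "mod2_sum (\<lambda>e. e) x = Q'"
      using less.hyps[of Q'] fin by blast
    have "Restr adj4 bg \<subseteq> {(a, b). a \<noteq> b \<and> {a, b} \<in> {e \<in> base_edges w h. e \<inter> F = {}}}"
      unfolding base_edges_def by (auto simp: adj4_def)
    then have "(p, q) \<in> {(a, b). a \<noteq> b \<and> {a, b} \<in> {e \<in> base_edges w h. e \<inter> F = {}}}\<^sup>*"
      using q(1) rtrancl_mono unfolding region_def by blast
    then obtain y where y: "finite y" "y \<subseteq> {e \<in> base_edges w h. e \<inter> F = {}}"
        "mod2_sum (\<lambda>e. e) y = sym_diff {p} {q}"
      by (rule rtrancl_edge_chain)
    have "finite x" using finite_subset[OF x(1)] by simp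
    then have "mod2_sum (\<lambda>e. e) (sym_diff x y) = sym_diff Q' (sym_diff {p} {q})"
      using mod2_sum_sym_diff[of x y "\<lambda>e. e"] x(2) y by simp
    also have "\<dots> = Q" using p q by (auto simp: Q'_def)
    finally have "mod2_sum (\<lambda>e. e) (sym_diff x y) = Q" .
    moreover have "sym_diff x y \<subseteq> {e \<in> base_edges w h. e \<inter> F = {}}" using x(1) y(2) by blast
    ultimately show ?thesis by blast
  qed
qed

text \<open>
  A cochain with even degree at the object pixels that meets every hole cut evenly becomes a cycle
  of the pixel graph when joined to suitable background edges, hence it is a dual cut.
\<close>

lemma coboundary_if_even:
  assumes "d \<subseteq> object_edges" "mod2_sum (\<lambda>e. e) d \<inter> F = {}"
    and "\<And>i. i \<in> {1..m} \<Longrightarrow> even (card (hole_cut i \<inter> d))"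
  shows "d \<in> coboundaries1 K"
proof -
  have db: "d \<subseteq> base_edges w h" using assms(1) by blast
  have find: "finite d" using assms(1) finite_object_edges by (rule finite_subset)
  define Q where "Q = mod2_sum (\<lambda>e. e) d"
  have "x \<in> pixels w h" if x: "x \<in> Q" for x
  proof -
    have "{e \<in> d. x \<in> e} \<noteq> {}" using x unfolding Q_def mem_mod2_sum by (metis card.empty even_zero)
    then show ?thesis using db base_edges_subset_pixels by blast
  qed
  then have Qbg: "Q \<subseteq> bg" using assms(2) unfolding Q_def by blast
  have finQ: "finite Q" using Qbg finite_subset[of Q bg] by simp
  have parity: "odd (card (X \<inter> Q)) \<longleftrightarrow> odd (card {e \<in> d. odd (card (X \<inter> e))})" if "finite X" for X
    unfolding Q_def by (rule odd_card_Int_mod2_sum[OF that find])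
  have hole: "even (card (Hole i \<inter> Q))" if i: "i \<in> {1..m}" for i
  proof -
    have "finite (Hole i)" using verts_level(1)[OF order_refl verts_n(3)[OF i]] finite_subset finite_pixels by blast
    moreover have "{e \<in> d. odd (card (Hole i \<inter> e))} = hole_cut i \<inter> d"
      unfolding hole_cut_odd using db by blast
    ultimately show ?thesis using parity[of "Hole i"] assms(3)[OF i] by simp
  qed
  \<comment> \<open>No cycle around the outside is tested. Its parity follows from the others:
    \<open>Q\<close> is even altogether, as every edge has two pixels, and each hole takes an even
    share.\<close>
  have outside: "even (card (outside w h F \<inter> Q))"
  proof -
    have "even (card (pixels w h \<inter> e))" if "e \<in> d" for e
    proof -
      have e: "e \<in> base_edges w h" using that db by blast
      then show ?thesis
        using odd_card_Int_base_edge[OF e, of "pixels w h"] base_edges_subset_pixels[OF e] by auto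
    qed
    then have "{e \<in> d. odd (card (pixels w h \<inter> e))} = {}" by simp
    then have "even (card (pixels w h \<inter> Q))"
      using parity[of "pixels w h"] by (simp only: card.empty even_zero simp_thms finite_pixels)
    moreover have "pixels w h \<inter> Q = Q" using Qbg by blast
    ultimately have evenQ: "even (card Q)" by simp
    define H where "H = (\<Union>i\<in>{1..m}. Hole i \<inter> Q)"
    have disj: "Hole i \<inter> Hole j = {}" if "i \<in> {1..m}" "j \<in> {1..m}" "i \<noteq> j" for i j
    proof -
      have "Hole i \<noteq> Hole j" using Hole that unfolding bij_betw_def by (metis inj_onD)
      then show ?thesis
        using wf_mgraph_disjoint[OF wf_G[OF order_refl] verts_n(3)[OF that(1)] verts_n(3)[OF that(2)]] by blast
    qed
    have "card H = (\<Sum>i\<in>{1..m}. card (Hole i \<inter> Q))"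
      unfolding H_def using finQ disj by (intro card_UN_disjoint) blast+
    then have evenH: "even (card H)" using hole by (metis dvd_sum)
    have "outside w h F \<inter> Hole i = {}" if "i \<in> {1..m}" for i
      using wf_mgraph_disjoint[OF wf_G[OF order_refl] verts_n(2) verts_n(3)[OF that]] Hole_neq[OF that] by blast
    then have "(outside w h F \<inter> Q) \<inter> H = {}" unfolding H_def by blast
    moreover have "Q = (outside w h F \<inter> Q) \<union> H"
    proof -
      have "x \<in> outside w h F \<or> (\<exists>i\<in>{1..m}. x \<in> Hole i)" if "x \<in> Q" for x
        using region_cases[of x] region_refl[of x bg] that Qbg by auto
      then show ?thesis unfolding H_def by blast
    qed
    moreover have "finite (outside w h F \<inter> Q)" "finite H" using finQ unfolding H_def by simp_all
    ultimately have "card Q = card (outside w h F \<inter> Q) + card H" by (metis card_Un_disjoint)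
    then show ?thesis using evenQ evenH by simp
  qed
  have "even (card (region bg p \<inter> Q))" if "p \<in> bg" for p
    using region_cases[OF that] outside hole by auto
  then obtain x where x: "x \<subseteq> {e \<in> base_edges w h. e \<inter> F = {}}" "mod2_sum (\<lambda>e. e) x = Q"
    using region_even_join[OF finQ Qbg] by blast
  have finx: "finite x" using finite_subset[OF x(1)] by simp
  let ?z = "sym_diff d x"
  have "mod2_sum (\<lambda>e. e) ?z = {}"
    using mod2_sum_sym_diff[OF find finx, of "\<lambda>e. e"] x(2) Q_def by simp
  moreover have "?z \<subseteq> base_edges w h" using db x(1) by blast
  ultimately obtain A where A: "\<And>e. e \<in> base_edges w h \<Longrightarrow> e \<in> ?z \<longleftrightarrow> odd (card (A \<inter> sides e))"
    using grid_cycle_is_dual_cut[of ?z w h] by metis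
  \<comment> \<open>Enclosed grid points outside the complex are dropped to obtain a 0-cochain of
    \<open>K\<close>; the ends of object edges all lie in \<open>cverts K\<close>, so no parity
    changes.\<close>
  define a where "a = (\<lambda>c. {c}) ` A \<inter> cverts K"
  have "e \<in> d \<longleftrightarrow> odd (card (a \<inter> bd1 K e))" if e: "e \<in> object_edges" for e
  proof -
    have "ends (Gd 0) e \<subseteq> cverts K" unfolding K_simps(3) using e by (rule UN_upper)
    then have "cverts K \<inter> (\<lambda>c. {c}) ` sides e = (\<lambda>c. {c}) ` sides e"
      unfolding ends_Gd_0_object[OF e] by (rule Int_absorb1)
    then have "a \<inter> bd1 K e = (\<lambda>c. {c}) ` A \<inter> (\<lambda>c. {c}) ` sides e"
      unfolding a_def bd1_K[OF e] Int_assoc by (rule arg_cong)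
    also have "\<dots> = (\<lambda>c. {c}) ` (A \<inter> sides e)" by (rule image_Int[symmetric]) simp
    finally have "a \<inter> bd1 K e = (\<lambda>c. {c}) ` (A \<inter> sides e)" .
    then have "card (a \<inter> bd1 K e) = card (A \<inter> sides e)" by (simp add: card_image)
    \<comment> \<open>The added edges \<open>x\<close> avoid the object, so the cycle and
      \<open>d\<close> agree on the edges of \<open>K\<close>.\<close>
    moreover have "e \<in> d \<longleftrightarrow> e \<in> ?z" using e x(1) by blast
    ultimately show ?thesis using A[of e] e by simp
  qed
  then have "d = coboundary0 K a"
    using assms(1) unfolding coboundary0_def K_simps(2) by blast
  then show ?thesis unfolding coboundaries1_def a_def by blast
qed

lemma co_basis: "cocycle_basis1 K co {1..m}"
  unfolding cocycle_basis1_def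
proof (intro conjI ballI)
  show "co i \<in> cocycles1 K" if "i \<in> {1..m}" for i using co_cocycle[OF that] .
next
  fix z assume z: "z \<in> cocycles1 K"
  have zo: "z \<subseteq> object_edges" using z by (simp add: cocycles1_def K_simps)
  \<comment> \<open>Because the pairing matrix is the identity, the coefficients of \<open>z\<close>
    are its parities on the hole cuts. The difference then meets every hole cut evenly.\<close>
  define J where "J = {j \<in> {1..m}. odd (card (hole_cut j \<inter> z))}"
  have J: "J \<subseteq> {1..m}" "finite J" by (auto simp: J_def)
  let ?s = "mod2_sum co J" and ?d = "sym_diff z (mod2_sum co J)"
  have s: "?s \<subseteq> object_edges"
  proof
    fix e assume "e \<in> ?s"
    then have "{j \<in> J. e \<in> co j} \<noteq> {}" unfolding mem_mod2_sum by (metis card.empty even_zero)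
    then show "e \<in> object_edges" using J(1) co_object by blast
  qed
  have "?d \<in> coboundaries1 K"
  proof (rule coboundary_if_even)
    show "?d \<subseteq> object_edges" using zo s by blast
    have "p \<notin> mod2_sum (\<lambda>e. e) ?d" if p: "p \<in> F" for p
    proof -
      let ?B = "bd2 K {p}"
      have f: "{p} \<in> cfaces K" using p by (simp add: K_simps)
      have even: "even (card (?B \<inter> c))" if "c \<in> cocycles1 K" for c
        using that f by (auto simp: cocycles1_def coboundary1_def Int_commute)
      have finB: "finite ?B" by (simp add: bd2_K)
      have "{j \<in> J. odd (card (?B \<inter> co j))} = {}" using even co_cocycle J(1) by blast
      then have "even (card (?B \<inter> ?s))"
        using odd_card_Int_mod2_sum[OF finB J(2), of co]
        by (simp only: card.empty even_zero simp_thms)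
      then have "even (card (?B \<inter> ?d))"
        using odd_card_Int_sym_diff[OF finB] even[OF z] by blast
      moreover have "{e \<in> ?d. p \<in> e} = ?B \<inter> ?d" unfolding bd2_K using zo s by blast
      ultimately show ?thesis unfolding mem_mod2_sum by simp
    qed
    then show "mod2_sum (\<lambda>e. e) ?d \<inter> F = {}" by blast
    fix i assume i: "i \<in> {1..m}"
    have "{j \<in> J. odd (card (hole_cut i \<inter> co j))} = {j \<in> J. i = j}"
      using odd_hole_cut_Int_co[OF i] J(1) by blast
    also have "\<dots> = (if i \<in> J then {i} else {})" by auto
    finally have "odd (card (hole_cut i \<inter> ?s)) \<longleftrightarrow> i \<in> J"
      using odd_card_Int_mod2_sum[OF finite_hole_cut J(2), of i co] by simp
    then show "even (card (hole_cut i \<inter> ?d))"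
      using odd_card_Int_sym_diff[OF finite_hole_cut, of i z ?s] i unfolding J_def by blast
  qed
  moreover have "z = sym_diff ?s ?d" by blast
  ultimately show "\<exists>J'\<subseteq>{1..m}. \<exists>b\<in>coboundaries1 K. z = sym_diff (mod2_sum co J') b"
    using J(1) by blast
next
  fix i assume i: "i \<in> {1..m}"
  show "\<not> (\<exists>J'\<subseteq>{1..m} - {i}. \<exists>b\<in>coboundaries1 K. co i = sym_diff (mod2_sum co J') b)"
  proof
    assume "\<exists>J'\<subseteq>{1..m} - {i}. \<exists>b\<in>coboundaries1 K. co i = sym_diff (mod2_sum co J') b"
    then obtain J b where J: "J \<subseteq> {1..m} - {i}" and b: "b \<in> coboundaries1 K"
      and eq: "co i = sym_diff (mod2_sum co J) b" by blast
    have finJ: "finite J" using J finite_subset by blast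
    \<comment> \<open>Test the supposed relation on \<open>hole_cut i\<close>: the other cocycles
      and the coboundary pair evenly with it, but \<open>co i\<close> pairs oddly.\<close>
    have "{j \<in> J. odd (card (hole_cut i \<inter> co j))} = {}"
      using odd_hole_cut_Int_co[OF i] J by blast
    then have "even (card (hole_cut i \<inter> mod2_sum co J))"
      using odd_card_Int_mod2_sum[OF finite_hole_cut finJ, of i co]
      by (simp only: card.empty even_zero simp_thms)
    moreover have "even (card (hole_cut i \<inter> b))"
      by (rule cycle_Int_coboundary[OF hole_cut_cycle[OF i] b])
    ultimately have "even (card (hole_cut i \<inter> co i))"
      unfolding eq using odd_card_Int_sym_diff[OF finite_hole_cut] by blast
    then show False using odd_hole_cut_Int_co[OF i i] by simp
  qed
qed

end

theorem proposition5p2: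
  fixes w h n m :: nat and F :: "point set"
    and G Gd :: "nat \<Rightarrow> (point, edge) mgraph"
    and T S :: "nat \<Rightarrow> edge set" and R :: "nat \<Rightarrow> point set set"
    and Z :: "edge set" and Hole :: "nat \<Rightarrow> point set"
    and \<alpha> :: "nat \<Rightarrow> edge" and \<beta> :: edge
    and K0 KH :: "(point set, edge, point set) cell_complex"
    and GH GdH :: "(point, edge) mgraph"
  assumes image: "binary_image w h F"
    and pyramid: "graph_pyramid w h F n G Gd T R S"
    and K0: "K0 = boundary_complex F (G 0) (Gd 0)"
    and tree: "spanning_tree (Gd n) Z"
    and GH: "GH = remove Z (G n)" and GdH: "GdH = contract Z (Gd n)"
    and KH: "KH = boundary_complex F GH GdH"
    and holes: "bij_betw Hole {1..m} (holes w h F)"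
    and \<alpha>: "\<And>i. i \<in> {1..m} \<Longrightarrow> \<alpha> i \<in> cedges KH \<and> ends GH (\<alpha> i) = {F, Hole i}"
    and \<beta>: "\<beta> \<in> cedges KH \<and> ends GH \<beta> = {F, outside w h F}"
  shows "(\<forall>i\<in>{1..m}. \<forall>g\<in>cycles1 K0.
            homologous1 K0 g (cycle_down_projection K0 (contracted_edges n Gd T S Z) (\<alpha> i)) \<longrightarrow>
            odd (card (cocycle_down_projection F G T R n {\<alpha> i, \<beta>} \<inter> g))) \<and>
         (\<forall>i\<in>{1..m}. cocycle_down_projection F G T R n {\<alpha> i, \<beta>} \<in> cocycles1 K0) \<and>
         cocycle_basis1 K0 (\<lambda>i. cocycle_down_projection F G T R n {\<alpha> i, \<beta>}) {1..m}"
proof -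
  \<comment> \<open>Removing \<open>Z\<close> leaves \<open>ends\<close> unchanged, so the data on
    the homology-generator level become statements about \<open>G n\<close>, as the locale
    expects.\<close>
  have "cedges KH \<subseteq> edges (G n) - Z"
    by (auto simp: KH GH boundary_complex_def Let_def)
  moreover have "ends GH = ends (G n)" by (simp add: GH)
  ultimately interpret generators w h n F G Gd T S R m Z Hole \<alpha> \<beta>
    using image pyramid tree holes \<alpha> \<beta> by unfold_locales auto
  have "K0 = K" by (simp add: K0 K_def)
  then show ?thesis
    using co_blocks_hole co_cocycle co_basis cycle_down_projection_eq by simp
qed

end
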